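(* Let $m\ge 0$ be an integer, let $g$ be an entire function on $\mathbb{C}$, let $0<p,q<\infty$, and consider $I_gf(z)=\int_0^z f'(w)g(w)\,dw$. (1) If $0<p\le q<\infty$, then $I_g:\mathcal{F}_{\psi_m}^p\to\mathcal{F}_{\psi_m}^q$ is (a) bounded if and only if $g$ is a constant function; (b) compact if and only if $g$ is the zero function. (2) If $0<q<p<\infty$, then the following are equivalent: (a) $I_g:\mathcal{F}_{\psi_m}^p\to\mathcal{F}_{\psi_m}^q$ is bounded; (b) $I_g:\mathcal{F}_{\psi_m}^p\to\mathcal{F}_{\psi_m}^q$ is compact; (c) $g$ is the zero function.
   Context: For an integer $m\ge 0$ let $\psi_m(z)=\frac12|z|^2-m\log(1+|z|)$, $z\in\mathbb{C}$. For $0<p<\infty$, $\mathcal{F}_{\psi_m}^p$ is the space of all entire functions $f$ with $\|f\|_{(p,m)}^p:=\int_{\mathbb{C}}|f(z)|^pe^{-p\psi_m(z)}\,dA(z)<\infty$, where $dA$ is Lebesgue area measure on $\mathbb{C}$. *)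

theory Defs
  imports "HOL-Complex_Analysis.Complex_Analysis"
begin

definition psi :: "nat \<Rightarrow> complex \<Rightarrow> real" where
  "psi m z = (norm z)^2 / 2 - real m * ln (1 + norm z)"

definition fock_integral :: "real \<Rightarrow> nat \<Rightarrow> (complex \<Rightarrow> complex) \<Rightarrow> ennreal" where
  "fock_integral p m f =
     (\<integral>\<^sup>+ z. ennreal ((norm (f z)) powr p * exp (- p * psi m z)) \<partial>lborel)"

definition fock_space :: "real \<Rightarrow> nat \<Rightarrow> (complex \<Rightarrow> complex) set" where
  "fock_space p m = {f. f holomorphic_on UNIV \<and> fock_integral p m f < \<infinity>}"

definition fock_norm :: "real \<Rightarrow> nat \<Rightarrow> (complex \<Rightarrow> complex) \<Rightarrow> real" where
  "fock_norm p m f = (enn2real (fock_integral p m f)) powr (1 / p)"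

definition volterra :: "(complex \<Rightarrow> complex) \<Rightarrow> (complex \<Rightarrow> complex) \<Rightarrow> complex \<Rightarrow> complex" where
  "volterra g f z = contour_integral (linepath 0 z) (\<lambda>w. deriv f w * g w)"

definition volterra_bounded :: "nat \<Rightarrow> (complex \<Rightarrow> complex) \<Rightarrow> real \<Rightarrow> real \<Rightarrow> bool" where
  "volterra_bounded m g p q \<longleftrightarrow>
     (\<forall>f \<in> fock_space p m. volterra g f \<in> fock_space q m) \<and>
     (\<exists>C. \<forall>f \<in> fock_space p m. fock_norm q m (volterra g f) \<le> C * fock_norm p m f)"

text \<open>Compactness: the image of the unit ball is relatively compact in F^q (metric space with
  distance ||f-h||_q^min(1,q)); expressed sequentially.\<close>
definition volterra_compact :: "nat \<Rightarrow> (complex \<Rightarrow> complex) \<Rightarrow> real \<Rightarrow> real \<Rightarrow> bool" where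
  "volterra_compact m g p q \<longleftrightarrow>
     (\<forall>f \<in> fock_space p m. volterra g f \<in> fock_space q m) \<and>
     (\<forall>fs :: nat \<Rightarrow> complex \<Rightarrow> complex.
        (\<forall>n. fs n \<in> fock_space p m \<and> fock_norm p m (fs n) \<le> 1) \<longrightarrow>
        (\<exists>r h. strict_mono r \<and> h \<in> fock_space q m \<and>
           (\<lambda>n. fock_norm q m (\<lambda>z. volterra g (fs (r n)) z - h z)) \<longlonglongrightarrow> 0))"

end

theory Submission
  imports Defs
begin

text \<open>
  Multiplying an entire function \<open>F\<close> by a suitable exponential turns \<open>|F| e\<^sup>-\<^sup>\<psi>\<close> near a point \<open>w\<close> into
  the modulus of an entire function up to constants, so subharmonicity bounds \<open>|F(w)| e\<^sup>-\<^sup>\<psi>\<close> and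
  \<open>|F'(w)| e\<^sup>-\<^sup>\<psi> / (1 + |w|)\<close> by the local part of the norm. Applied to \<open>I\<^sub>g f\<close>, whose derivative is
  \<open>f' g\<close>, with \<open>f\<close> a normalised kernel function at \<open>w\<close>, this shows that \<open>g\<close> is bounded if the operator
  is bounded, and that \<open>g\<close> vanishes at infinity if it is compact; Liouville's theorem does the rest.
  Conversely, a constant \<open>g\<close> gives \<open>c (f - f(0))\<close>, and the pointwise bound yields the inclusion of the
  \<open>p\<close>-space in the \<open>q\<close>-space for \<open>p \<le> q\<close>. For \<open>q < p\<close> the monomials show that this inclusion is
  unbounded: \<open>z\<^sup>n\<close> lives on an annulus of area comparable to \<open>\<surd>n\<close>.
\<close>

section \<open>Area means of entire functions\<close>

lemma nn_integral_lborel_translate: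
  fixes f :: "'a::euclidean_space \<Rightarrow> ennreal"
  assumes [measurable]: "f \<in> borel_measurable borel"
  shows "(\<integral>\<^sup>+x. f (a + x) \<partial>lborel) = (\<integral>\<^sup>+x. f x \<partial>lborel)"
proof -
  have "(\<integral>\<^sup>+x. f x \<partial>lborel) = (\<integral>\<^sup>+x. f x \<partial>distr lborel borel ((+) a))"
    by (simp add: lborel_distr_plus)
  also have "\<dots> = (\<integral>\<^sup>+x. f (a + x) \<partial>lborel)"
    by (rule nn_integral_distr) auto
  finally show ?thesis by simp
qed

lemma emeasure_complex_cball:
  assumes "0 \<le> r" shows "emeasure lborel (cball (c::complex) r) = ennreal (pi * r\<^sup>2)"
  using emeasure_cball[OF assms, of c] by (simp add: unit_ball_vol_2)

lemma sets_borel_cball [measurable, simp]: "cball (a::'a::euclidean_space) r \<in> sets borel"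
  by (simp add: borel_closed)

text \<open>Integrating \<open>g\<close> against the indicator of a disc in both variables and translating one
  variable at a time compares the rotated integral with the original one.\<close>
lemma nn_integral_lborel_rotate:
  fixes g :: "complex \<Rightarrow> ennreal"
  assumes [measurable]: "g \<in> borel_measurable borel" and c: "norm c = 1"
  shows "(\<integral>\<^sup>+y. g (c * y) \<partial>lborel) = (\<integral>\<^sup>+y. g y \<partial>lborel)"
proof -
  let ?B = "cball (0::complex) 1"
  have c0: "c \<noteq> 0" using c by auto
  have "ennreal pi * (\<integral>\<^sup>+y. g (c * y) \<partial>lborel) = (\<integral>\<^sup>+x. indicator ?B x * (\<integral>\<^sup>+y. g (c * y) \<partial>lborel) \<partial>lborel)"
    by (subst nn_integral_multc) (auto simp: emeasure_complex_cball)
  also have "\<dots> = (\<integral>\<^sup>+x. indicator ?B x * (\<integral>\<^sup>+y. g (c * y + x) \<partial>lborel) \<partial>lborel)"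
  proof (rule nn_integral_cong, rule arg_cong2[where f="(*)", OF refl])
    fix x
    show "(\<integral>\<^sup>+y. g (c * y) \<partial>lborel) = (\<integral>\<^sup>+y. g (c * y + x) \<partial>lborel)"
      using nn_integral_lborel_translate[of "\<lambda>y. g (c * y)" "x / c"] c0
      by (simp add: algebra_simps)
  qed
  also have "\<dots> = (\<integral>\<^sup>+x. (\<integral>\<^sup>+y. indicator ?B x * g (c * y + x) \<partial>lborel) \<partial>lborel)"
    by (intro nn_integral_cong nn_integral_cmult[symmetric]) auto
  also have "\<dots> = (\<integral>\<^sup>+y. (\<integral>\<^sup>+x. indicator ?B x * g (c * y + x) \<partial>lborel) \<partial>lborel)"
    by (rule lborel_pair.Fubini') auto
  also have "\<dots> = (\<integral>\<^sup>+y. (\<integral>\<^sup>+x. indicator ?B (x - c * y) * g x \<partial>lborel) \<partial>lborel)"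
  proof (rule nn_integral_cong)
    fix y
    show "(\<integral>\<^sup>+x. indicator ?B x * g (c * y + x) \<partial>lborel) = (\<integral>\<^sup>+x. indicator ?B (x - c * y) * g x \<partial>lborel)"
      using nn_integral_lborel_translate[of "\<lambda>x. indicator ?B (x - c * y) * g x" "c * y"]
      by (simp add: algebra_simps)
  qed
  also have "\<dots> = (\<integral>\<^sup>+x. (\<integral>\<^sup>+y. indicator ?B (x - c * y) * g x \<partial>lborel) \<partial>lborel)"
    by (rule lborel_pair.Fubini') auto
  also have "\<dots> = (\<integral>\<^sup>+x. ennreal pi * g x \<partial>lborel)"
  proof (rule nn_integral_cong)
    fix x
    \<comment> \<open>Since |c| = 1, the condition on \<open>y\<close> describes a unit disc about
      \<open>x / c\<close>. Its area is pi whatever \<open>x\<close> is.\<close>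
    have "norm (x - c * y) = norm (x / c - y)" for y
    proof -
      have "norm (x / c - y) = norm (c * (x / c - y))" by (simp add: norm_mult c)
      also have "c * (x / c - y) = x - c * y" using c0 by (simp add: algebra_simps)
      finally show ?thesis by simp
    qed
    then have "indicator ?B (x - c * y) = (indicator (cball (x / c) 1) y :: ennreal)" for y
      by (simp add: indicator_def dist_norm norm_minus_commute[of "c * y" x])
    then show "(\<integral>\<^sup>+y. indicator ?B (x - c * y) * g x \<partial>lborel) = ennreal pi * g x"
      by (simp add: nn_integral_multc emeasure_complex_cball)
  qed
  also have "\<dots> = ennreal pi * (\<integral>\<^sup>+y. g y \<partial>lborel)"
    by (rule nn_integral_cmult) auto
  finally show ?thesis
    by (simp add: ennreal_mult_cancel_left)
qed

section \<open>Sub-mean value inequalities for |F| and its powers\<close>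

text \<open>Cauchy's formula at 0 for \<open>\<lambda>u. F (u * z)\<close> on the unit circle. With
  \<open>z\<close> inside the function, the contour is the same for all radii, including radius
  0.\<close>

lemma entire_circle_mean:
  assumes F: "F holomorphic_on UNIV"
  shows "((\<lambda>t. F (exp (2 * pi * \<i> * of_real t) * z)) has_integral F 0) {0..1}"
proof -
  have "F \<circ> (\<lambda>u. u * z) holomorphic_on UNIV"
    by (rule holomorphic_on_compose_gen[OF _ F]) (auto intro!: holomorphic_intros)
  then have "(\<lambda>u. F (u * z)) holomorphic_on UNIV"
    by (simp add: o_def)
  then have "((\<lambda>u. F (u * z) / (u - 0)) has_contour_integral (2 * of_real pi * \<i> * F (0 * z))) (circlepath 0 1)"
    by (intro Cauchy_integral_circlepath_simple) (auto intro: holomorphic_on_subset)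
  then have "((\<lambda>t. F (circlepath 0 1 t * z) / (circlepath 0 1 t - 0) * vector_derivative (circlepath 0 1) (at t within {0..1}))
      has_integral (2 * of_real pi * \<i> * F 0)) {0..1}"
    unfolding has_contour_integral_def by simp
  \<comment> \<open>The tangent vector of the unit circle is \<open>2 * pi * \<i>\<close> times the
    point itself, which cancels the denominator.\<close>
  from has_integral_eq[OF _ this, of "\<lambda>t. 2 * of_real pi * \<i> * F (exp (2 * pi * \<i> * of_real t) * z)"]
  have "((\<lambda>t. 2 * of_real pi * \<i> * F (exp (2 * pi * \<i> * of_real t) * z)) has_integral (2 * of_real pi * \<i> * F 0)) {0..1}"
    by (simp add: vector_derivative_circlepath01) (simp add: circlepath)
  from has_integral_mult_right[OF this, of "1 / (2 * of_real pi * \<i>)"]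
  show ?thesis by simp
qed

lemma entire_circle_mean_le:
  assumes F: "F holomorphic_on UNIV"
  shows "ennreal (norm (F 0)) \<le> (\<integral>\<^sup>+t. ennreal (norm (F (exp (2 * pi * \<i> * of_real t) * z))) * indicator {0..1} t \<partial>lborel)"
proof -
  have contF: "continuous_on A F" for A
    using F holomorphic_on_imp_continuous_on continuous_on_subset by blast
  let ?h = "\<lambda>t::real. F (exp (2 * pi * \<i> * of_real t) * z)"
  have cont: "continuous_on A ?h" for A
    by (intro continuous_on_compose2[OF contF[of UNIV]] continuous_intros) auto
  have int: "(\<lambda>t. norm (?h t)) integrable_on {0..1}"
    by (intro integrable_continuous_real continuous_intros cont)
  have "norm (F 0) \<le> integral {0..1} (\<lambda>t. norm (?h t))"
  proof -
    have "norm (integral {0..1} ?h) \<le> integral {0..1} (\<lambda>t. norm (?h t))"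
      using has_integral_integrable[OF entire_circle_mean[OF F, of z]] int
      by (intro integral_norm_bound_integral) auto
    then show ?thesis by (simp only: integral_unique[OF entire_circle_mean[OF F, of z]])
  qed
  moreover have "(\<integral>\<^sup>+t. ennreal (norm (?h t)) * indicator {0..1} t \<partial>lborel) = ennreal (integral {0..1} (\<lambda>t. norm (?h t)))"
    by (rule nn_integral_has_integral_lebesgue'[OF _ integrable_integral[OF int]]) auto
  ultimately show ?thesis by (simp add: ennreal_leI)
qed

lemma entire_borel:
  "F holomorphic_on UNIV \<Longrightarrow> F \<in> borel_measurable borel"
  by (intro borel_measurable_continuous_onI holomorphic_on_imp_continuous_on)

text \<open>Rotation invariance replaces polar coordinates: the circle inequality is integrated over
  all \<open>z\<close> in the disc, the integrals are exchanged, and the inner integral over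
  \<open>z\<close> is then the same for every angle \<open>t\<close>.\<close>

lemma entire_disc_mean_le_0:
  assumes F: "F holomorphic_on UNIV" and r: "0 \<le> r"
  shows "ennreal (pi * r\<^sup>2 * norm (F 0)) \<le> (\<integral>\<^sup>+z. ennreal (norm (F z)) * indicator (cball 0 r) z \<partial>lborel)"
proof -
  note [measurable] = entire_borel[OF F]
  let ?e = "\<lambda>t::real. exp (2 * pi * \<i> * of_real t)"
  have [measurable]: "?e \<in> borel_measurable borel"
    by (intro borel_measurable_continuous_onI continuous_intros)
  have "ennreal (pi * r\<^sup>2 * norm (F 0)) = (\<integral>\<^sup>+z. ennreal (norm (F 0)) * indicator (cball (0::complex) r) z \<partial>lborel)"
    using r by (simp add: nn_integral_cmult emeasure_complex_cball ennreal_mult' mult_ac)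
  also have "\<dots> \<le> (\<integral>\<^sup>+z. (\<integral>\<^sup>+t. ennreal (norm (F (?e t * z))) * indicator {0..1} t \<partial>lborel) * indicator (cball 0 r) z \<partial>lborel)"
    by (rule nn_integral_mono, rule mult_right_mono[OF entire_circle_mean_le[OF F]]) simp
  also have "\<dots> = (\<integral>\<^sup>+z. (\<integral>\<^sup>+t. ennreal (norm (F (?e t * z))) * indicator {0..1} t * indicator (cball 0 r) z \<partial>lborel) \<partial>lborel)"
    by (intro nn_integral_cong nn_integral_multc[symmetric]) auto
  also have "\<dots> = (\<integral>\<^sup>+t. (\<integral>\<^sup>+z. ennreal (norm (F (?e t * z))) * indicator {0..1} t * indicator (cball 0 r) z \<partial>lborel) \<partial>lborel)"
    by (rule lborel_pair.Fubini') auto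
  also have "\<dots> = (\<integral>\<^sup>+t. (\<integral>\<^sup>+z. ennreal (norm (F z)) * indicator (cball 0 r) z \<partial>lborel) * indicator {0..1::real} t \<partial>lborel)"
  proof (rule nn_integral_cong)
    fix t :: real
    have e: "norm (?e t) = 1" by simp
    have "(\<integral>\<^sup>+z. ennreal (norm (F (?e t * z))) * indicator {0..1} t * indicator (cball 0 r) z \<partial>lborel)
        = (\<integral>\<^sup>+z. ennreal (norm (F (?e t * z))) * indicator (cball 0 r) (?e t * z) * indicator {0..1} t \<partial>lborel)"
      by (intro nn_integral_cong) (auto simp: indicator_def norm_mult)
    also have "\<dots> = (\<integral>\<^sup>+z. ennreal (norm (F (?e t * z))) * indicator (cball 0 r) (?e t * z) \<partial>lborel) * indicator {0..1} t"
      by (intro nn_integral_multc) auto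
    also have "(\<integral>\<^sup>+z. ennreal (norm (F (?e t * z))) * indicator (cball 0 r) (?e t * z) \<partial>lborel)
       = (\<integral>\<^sup>+z. ennreal (norm (F z)) * indicator (cball 0 r) z \<partial>lborel)"
      by (rule nn_integral_lborel_rotate[OF _ e, of "\<lambda>z. ennreal (norm (F z)) * indicator (cball 0 r) z"]) auto
    finally show "(\<integral>\<^sup>+z. ennreal (norm (F (?e t * z))) * indicator {0..1} t * indicator (cball 0 r) z \<partial>lborel)
        = (\<integral>\<^sup>+z. ennreal (norm (F z)) * indicator (cball 0 r) z \<partial>lborel) * indicator {0..1::real} t" .
  qed
  also have "\<dots> = (\<integral>\<^sup>+z. ennreal (norm (F z)) * indicator (cball 0 r) z \<partial>lborel)"
    by (subst nn_integral_cmult) auto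
  finally show ?thesis .
qed

lemma entire_translate:
  fixes F :: "complex \<Rightarrow> complex"
  assumes "F holomorphic_on UNIV" shows "(\<lambda>z. F (a + z)) holomorphic_on UNIV"
proof -
  have "F \<circ> (\<lambda>z. a + z) holomorphic_on UNIV"
    by (rule holomorphic_on_compose_gen[OF _ assms]) (auto intro!: holomorphic_intros)
  then show ?thesis by (simp add: o_def)
qed

lemma entire_disc_mean_le:
  assumes F: "F holomorphic_on UNIV" and r: "0 \<le> r"
  shows "ennreal (pi * r\<^sup>2 * norm (F a)) \<le> (\<integral>\<^sup>+z. ennreal (norm (F z)) * indicator (cball a r) z \<partial>lborel)"
proof -
  note [measurable] = entire_borel[OF F]
  have *: "indicator (cball a r) (a + z) = (indicator (cball 0 r) z :: ennreal)" for z
    by (simp add: indicator_def dist_norm)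
  have "ennreal (pi * r\<^sup>2 * norm (F a)) \<le> (\<integral>\<^sup>+z. ennreal (norm (F (a + z))) * indicator (cball a r) (a + z) \<partial>lborel)"
    using entire_disc_mean_le_0[OF entire_translate[OF F] r, of a] by (simp only: * add_0_right)
  also have "\<dots> = (\<integral>\<^sup>+z. ennreal (norm (F z)) * indicator (cball a r) z \<partial>lborel)"
    by (rule nn_integral_lborel_translate) auto
  finally show ?thesis .
qed

text \<open>The Hardy--Littlewood device: at a maximum point of \<open>(1 - |z|)\<^sup>2\<^sup>/\<^sup>q |F z|\<close> the factor
  \<open>|F|\<^sup>1\<^sup>-\<^sup>q\<close> in the area mean of \<open>|F|\<close> can be absorbed into the left-hand side.\<close>
lemma entire_powr_disc_mean_le_small:
  assumes F: "F holomorphic_on UNIV" and q: "0 < q" "q \<le> 1"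
  shows "ennreal (norm (F 0) powr q) \<le> ennreal (4 / pi * (2 powr (2 / q)) powr (1 - q)) *
    (\<integral>\<^sup>+z. ennreal (norm (F z) powr q) * indicator (cball 0 1) z \<partial>lborel)"
    (is "_ \<le> ennreal ?C * ?I")
proof (cases "F 0 = 0 \<or> ?I = \<infinity>")
  case True
  then show ?thesis by (auto simp: ennreal_mult_top)
next
  case False
  then obtain J where J: "?I = ennreal J" "J \<ge> 0" by (cases ?I) auto
  note [measurable] = entire_borel[OF F]
  \<comment> \<open>This exponent makes \<open>(d powr a * M) powr q\<close> equal to
    \<open>d\<^sup>2 * M powr q\<close>, which matches the area of a disc of radius
    \<open>d/2\<close>.\<close>
  define a where "a = 2 / q"
  have a: "a > 0" "a * q = 2" using q by (auto simp: a_def)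
  let ?\<phi> = "\<lambda>z. (1 - norm z) powr a * norm (F z)"
  have "continuous_on (cball 0 1) ?\<phi>"
    using F a by (intro continuous_on_mult continuous_on_powr' continuous_on_norm continuous_on_diff
        continuous_on_const continuous_on_id holomorphic_on_imp_continuous_on[OF holomorphic_on_subset[OF F]]) auto
  from continuous_attains_sup[OF _ _ this]
  obtain z0 where z0: "z0 \<in> cball 0 1" "\<And>z. z \<in> cball 0 1 \<Longrightarrow> ?\<phi> z \<le> ?\<phi> z0"
    by auto
  \<comment> \<open>The weight vanishes on the unit circle, so a positive maximum is attained
    inside, and \<open>d\<close> is the distance of \<open>z0\<close> to the boundary.\<close>
  define d where "d = 1 - norm z0"
  define M where "M = norm (F z0)"
  have S: "norm (F 0) \<le> d powr a * M" using z0(2)[of 0] by (simp add: d_def M_def)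
  with False have "d powr a * M > 0" by (smt (verit) zero_less_norm_iff)
  with z0(1) have d: "d > 0" and M: "M > 0" 
    by (auto simp: zero_less_mult_iff d_def M_def)
  \<comment> \<open>On the disc of radius \<open>d/2\<close> the weight has dropped by at most the
    factor \<open>2 powr a\<close> from its value at \<open>z0\<close>, so maximality controls |F|
    there by a multiple of \<open>M\<close>.\<close>
  have bound: "norm (F z) \<le> 2 powr a * M" and sub: "z \<in> cball 0 1" if "z \<in> cball z0 (d/2)" for z
  proof -
    have "norm z \<le> norm z0 + d / 2"
      using that norm_triangle_ineq4[of z0 "z0 - z"] by (simp add: dist_norm)
    then have nz: "d / 2 \<le> 1 - norm z" by (simp add: d_def field_simps)
    with d show z: "z \<in> cball 0 1" by simp
    have "(d/2) powr a * norm (F z) \<le> ?\<phi> z"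
      using nz d a by (intro mult_right_mono powr_mono2) auto
    also have "\<dots> \<le> d powr a * M" using z0(2)[OF z] by (simp add: d_def M_def)
    finally show "norm (F z) \<le> 2 powr a * M"
      using d by (simp add: powr_divide field_simps)
  qed
  have "ennreal (pi * (d/2)\<^sup>2 * M) \<le> (\<integral>\<^sup>+z. ennreal (norm (F z)) * indicator (cball z0 (d/2)) z \<partial>lborel)"
    unfolding M_def using d by (intro entire_disc_mean_le F) auto
  also have "\<dots> \<le> (\<integral>\<^sup>+z. ennreal ((2 powr a * M) powr (1 - q)) * (ennreal (norm (F z) powr q) * indicator (cball 0 1) z) \<partial>lborel)"
  proof (rule nn_integral_mono)
    fix z
    have "norm (F z) \<le> (2 powr a * M) powr (1 - q) * norm (F z) powr q" if z: "z \<in> cball z0 (d/2)"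
    proof -
      have "norm (F z) = norm (F z) powr (1 - q) * norm (F z) powr q"
        by (cases "F z = 0") (simp_all flip: powr_add)
      also have "\<dots> \<le> (2 powr a * M) powr (1 - q) * norm (F z) powr q"
        using bound[OF z] q by (intro mult_right_mono powr_mono2) auto
      finally show ?thesis .
    qed
    then show "ennreal (norm (F z)) * indicator (cball z0 (d/2)) z \<le>
        ennreal ((2 powr a * M) powr (1 - q)) * (ennreal (norm (F z) powr q) * indicator (cball 0 1) z)"
      using sub[of z] by (auto simp: indicator_def ennreal_mult'[symmetric] intro!: ennreal_leI)
  qed
  also have "\<dots> = ennreal ((2 powr a * M) powr (1 - q)) * ennreal J"
    by (subst nn_integral_cmult) (auto simp: J)
  finally have "ennreal (pi * (d/2)\<^sup>2 * M) \<le> ennreal ((2 powr a * M) powr (1 - q) * J)"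
    by (simp add: ennreal_mult')
  then have "pi * (d/2)\<^sup>2 * M \<le> (2 powr a * M) powr (1 - q) * J"
    using J by (subst (asm) ennreal_le_iff) auto
  also have "\<dots> = (2 powr a) powr (1 - q) * J * M powr (1 - q)"
    using M by (simp add: powr_mult)
  finally have "(pi * (d/2)\<^sup>2 * M powr q) * M powr (1 - q) \<le> (2 powr a) powr (1 - q) * J * M powr (1 - q)"
    using M by (simp add: powr_diff field_simps)
  then have "pi * (d/2)\<^sup>2 * M powr q \<le> (2 powr a) powr (1 - q) * J"
    using M by simp
  then have "d\<^sup>2 * M powr q \<le> ?C * J"
    by (simp add: a_def field_simps power2_eq_square)
  moreover have "norm (F 0) powr q \<le> (d powr a * M) powr q"
    using S q by (intro powr_mono2) auto
  moreover have "(d powr a * M) powr q = d\<^sup>2 * M powr q"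
    using d M a by (simp add: powr_mult powr_powr)
  ultimately have "norm (F 0) powr q \<le> ?C * J" by simp
  then show ?thesis unfolding J
    by (subst ennreal_mult'[symmetric]) (auto intro!: ennreal_leI)
qed

text \<open>Exponents above 1 reduce to small ones: F^k is entire and \<open>s = q / k\<close> lies
  in (0,1], while |F^k|^s = |F|^q.\<close>

lemma entire_powr_disc_mean_le:
  assumes q: "0 < (q::real)"
  obtains C where "C > 0" "\<And>F a. F holomorphic_on UNIV \<Longrightarrow>
    ennreal (norm (F a) powr q) \<le> ennreal C * (\<integral>\<^sup>+z. ennreal (norm (F z) powr q) * indicator (cball a 1) z \<partial>lborel)"
proof -
  obtain k :: nat where k: "q \<le> real k" using real_arch_simple by blast
  with q have k0: "k > 0" by (cases k) auto
  define s where "s = q / real k"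
  have s: "0 < s" "s \<le> 1" using q k k0 by (auto simp: s_def)
  define C where "C = 4 / pi * (2 powr (2 / s)) powr (1 - s)"
  have eq: "norm (z ^ k) powr s = norm z powr q" for z :: complex
    using k0 by (cases "z = 0") (auto simp: s_def norm_power powr_powr simp flip: powr_realpow)
  show thesis
  proof
    show "C > 0" by (simp add: C_def)
    fix F :: "complex \<Rightarrow> complex" and a :: complex
    assume F: "F holomorphic_on UNIV"
    note [measurable] = entire_borel[OF F]
    have *: "indicator (cball a 1) (a + z) = (indicator (cball 0 1) z :: ennreal)" for z
      by (simp add: indicator_def dist_norm)
    have "(\<lambda>z. F (a + z) ^ k) holomorphic_on UNIV"
      by (intro holomorphic_on_power entire_translate F)
    from entire_powr_disc_mean_le_small[OF this s]
    have "ennreal (norm (F a) powr q) \<le> ennreal C * (\<integral>\<^sup>+z. ennreal (norm (F (a + z)) powr q) * indicator (cball a 1) (a + z) \<partial>lborel)"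
      by (simp only: eq C_def * add_0_right)
    also have "(\<integral>\<^sup>+z. ennreal (norm (F (a + z)) powr q) * indicator (cball a 1) (a + z) \<partial>lborel)
        = (\<integral>\<^sup>+z. ennreal (norm (F z) powr q) * indicator (cball a 1) z \<partial>lborel)"
      by (rule nn_integral_lborel_translate) auto
    finally show "ennreal (norm (F a) powr q) \<le> ennreal C * (\<integral>\<^sup>+z. ennreal (norm (F z) powr q) * indicator (cball a 1) z \<partial>lborel)" .
  qed
qed

text \<open>Cauchy's estimate bounds |F'(0)| by |F(a)| at a maximum point \<open>a\<close> on the
  unit circle. Unit discs about points of the closed unit disc stay inside radius 2, so one integral
  serves both the value and the derivative.\<close>

lemma entire_powr_jet_le:
  assumes q: "0 < (q::real)"
  obtains C where "C > 0"
    "\<And>F. F holomorphic_on UNIV \<Longrightarrow>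
      ennreal (norm (F 0) powr q) \<le> ennreal C * (\<integral>\<^sup>+z. ennreal (norm (F z) powr q) * indicator (cball 0 2) z \<partial>lborel)"
    "\<And>F. F holomorphic_on UNIV \<Longrightarrow>
      ennreal (norm (deriv F 0) powr q) \<le> ennreal C * (\<integral>\<^sup>+z. ennreal (norm (F z) powr q) * indicator (cball 0 2) z \<partial>lborel)"
proof -
  obtain C where C: "C > 0" "\<And>F a. F holomorphic_on UNIV \<Longrightarrow>
    ennreal (norm (F a) powr q) \<le> ennreal C * (\<integral>\<^sup>+z. ennreal (norm (F z) powr q) * indicator (cball a 1) z \<partial>lborel)"
    using entire_powr_disc_mean_le[OF q] by blast
  have near: "ennreal (norm (F a) powr q) \<le> ennreal C * (\<integral>\<^sup>+z. ennreal (norm (F z) powr q) * indicator (cball 0 2) z \<partial>lborel)"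
    if F: "F holomorphic_on UNIV" and a: "norm a \<le> 1" for F a
  proof -
    have "cball a 1 \<subseteq> cball 0 2"
      using a by (simp add: cball_subset_cball_iff)
    then have "(\<integral>\<^sup>+z. ennreal (norm (F z) powr q) * indicator (cball a 1) z \<partial>lborel)
      \<le> (\<integral>\<^sup>+z. ennreal (norm (F z) powr q) * indicator (cball 0 2) z \<partial>lborel)"
      by (intro nn_integral_mono mult_left_mono) (auto simp: indicator_def)
    then show ?thesis using C(2)[OF F, of a] by (meson mult_left_mono order_trans zero_le)
  qed
  show thesis
  proof (rule that[OF C(1)])
    fix F :: "complex \<Rightarrow> complex" assume F: "F holomorphic_on UNIV"
    show "ennreal (norm (F 0) powr q) \<le> ennreal C * (\<integral>\<^sup>+z. ennreal (norm (F z) powr q) * indicator (cball 0 2) z \<partial>lborel)"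
      using near[OF F, of 0] by simp
    have cont: "continuous_on A F" for A
      using F holomorphic_on_imp_continuous_on continuous_on_subset by blast
    have "continuous_on (sphere 0 1) (\<lambda>z. norm (F z))"
      by (intro continuous_intros cont)
    moreover have "(1::complex) \<in> sphere 0 1" by simp
    ultimately obtain a where a: "a \<in> sphere 0 1" "\<And>z. z \<in> sphere 0 1 \<Longrightarrow> norm (F z) \<le> norm (F a)"
      using continuous_attains_sup[of "sphere 0 1" "\<lambda>z. norm (F z)"] by (metis compact_sphere empty_iff)
    have "norm ((deriv ^^ 1) F 0) \<le> fact 1 * norm (F a) / 1 ^ 1"
      by (rule Cauchy_inequality[where r = 1]) (use cont a F in \<open>auto intro: holomorphic_on_subset\<close>)
    then have "norm (deriv F 0) powr q \<le> norm (F a) powr q"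
      using q by (intro powr_mono2) auto
    then have "ennreal (norm (deriv F 0) powr q) \<le> ennreal (norm (F a) powr q)"
      by (rule ennreal_leI)
    also have "\<dots> \<le> ennreal C * (\<integral>\<^sup>+z. ennreal (norm (F z) powr q) * indicator (cball 0 2) z \<partial>lborel)"
      using near[OF F, of a] a(1) by simp
    finally show "ennreal (norm (deriv F 0) powr q) \<le> ennreal C * (\<integral>\<^sup>+z. ennreal (norm (F z) powr q) * indicator (cball 0 2) z \<partial>lborel)" .
  qed
qed

section \<open>Weighted Fock spaces\<close>

lemma exp_minus_psi: "exp (- psi m z) = (1 + norm z) ^ m * exp (- (norm z)\<^sup>2 / 2)"
proof -
  have "(1 + norm z) ^ m = exp (real m * ln (1 + norm z))"
    by (simp add: exp_of_nat_mult add_pos_nonneg)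
  then show ?thesis by (simp add: psi_def flip: exp_add)
qed

lemma fock_weight_powr: "norm w powr p * exp (- p * psi m z) = (norm w * exp (- psi m z)) powr p"
  by (simp add: powr_mult exp_powr_real)

lemma fock_integral_alt:
  "fock_integral p m f = (\<integral>\<^sup>+z. ennreal ((norm (f z) * exp (- psi m z)) powr p) \<partial>lborel)"
  by (simp only: fock_integral_def fock_weight_powr)

lemma continuous_on_psi [continuous_intros]: "continuous_on A (psi m)"
  unfolding psi_def[abs_def]
  by (intro continuous_intros) (auto simp: add_nonneg_eq_0_iff)

lemma borel_measurable_psi [measurable]: "psi m \<in> borel_measurable borel"
  by (intro borel_measurable_continuous_onI continuous_intros)

text \<open>Here \<open>C\<close> is uniform in both \<open>F\<close> and \<open>w\<close>. The
  extra factor 1 + |w| for the derivative is the price of moving the Gaussian weight into an entire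
  factor whose logarithmic derivative at \<open>w\<close> is \<open>- cnj w\<close>.\<close>

lemma fock_pointwise:
  assumes q: "0 < (q::real)"
  obtains C where "C > 0"
    "\<And>F w. F holomorphic_on UNIV \<Longrightarrow>
      ennreal ((norm (F w) * exp (- psi m w)) powr q)
      \<le> ennreal C * (\<integral>\<^sup>+z. ennreal ((norm (F z) * exp (- psi m z)) powr q) * indicator (cball w 2) z \<partial>lborel)"
    "\<And>F w. F holomorphic_on UNIV \<Longrightarrow>
      ennreal ((norm (deriv F w) * exp (- psi m w) / (1 + norm w)) powr q)
      \<le> ennreal C * (\<integral>\<^sup>+z. ennreal ((norm (F z) * exp (- psi m z)) powr q) * indicator (cball w 2) z \<partial>lborel)"
proof -
  obtain C where C: "C > 0"
    "\<And>F. F holomorphic_on UNIV \<Longrightarrow>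
      ennreal (norm (F 0) powr q) \<le> ennreal C * (\<integral>\<^sup>+z. ennreal (norm (F z) powr q) * indicator (cball 0 2) z \<partial>lborel)"
    "\<And>F. F holomorphic_on UNIV \<Longrightarrow>
      ennreal (norm (deriv F 0) powr q) \<le> ennreal C * (\<integral>\<^sup>+z. ennreal (norm (F z) powr q) * indicator (cball 0 2) z \<partial>lborel)"
    using entire_powr_jet_le[OF q] by blast
  \<comment> \<open>For |u| at most 2 two things are lost: 1 + |w| is at most 3 (1 + |w + u|), which
    costs \<open>3 ^ m\<close>, and the term |u|^2 / 2 in the expansion of |w + u|^2 / 2 costs
    \<open>exp 2\<close>.\<close>
  define K where "K = 3 ^ m * exp (2::real)"
  have K: "K > 0" by (simp add: K_def)
  \<comment> \<open>Near \<open>u = 0\<close> the modulus of \<open>H F w u\<close> is comparable to \<open>|F (w + u)| e\<^sup>-\<^sup>\<psi>\<close>, uniformly in \<open>w\<close>.\<close>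
  define H where "H F w = (\<lambda>u. F (w + u) * (of_real ((1 + norm w) ^ m) * exp (- (u * cnj w) - of_real ((norm w)\<^sup>2 / 2))))"
    for F :: "complex \<Rightarrow> complex" and w :: complex
  have H0: "norm (H F w 0) = norm (F w) * exp (- psi m w)" for F w
    by (simp add: H_def norm_mult exp_minus_psi norm_power flip: of_real_add)
  have HK: "norm (H F w u) \<le> K * (norm (F (w + u)) * exp (- psi m (w + u)))" if u: "norm u \<le> 2" for F w u
  proof -
    have sq: "(norm (w + u))\<^sup>2 = (norm w)\<^sup>2 + 2 * Re (u * cnj w) + (norm u)\<^sup>2"
      by (simp add: cmod_power2) (simp add: power2_eq_square algebra_simps)
    have "1 + norm w \<le> 3 * (1 + norm (w + u))"
      using norm_triangle_ineq4[of "w + u" u] u by (smt (verit) add_diff_cancel_right' norm_ge_zero)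
    then have 1: "(1 + norm w) ^ m \<le> 3 ^ m * (1 + norm (w + u)) ^ m"
      by (metis add_nonneg_nonneg norm_ge_zero power_mono power_mult_distrib zero_le_one)
    have "(norm u)\<^sup>2 \<le> 2\<^sup>2" using u by (intro power_mono) auto
    then have 2: "exp (- Re (u * cnj w) - (norm w)\<^sup>2 / 2) \<le> exp 2 * exp (- (norm (w + u))\<^sup>2 / 2)"
      unfolding exp_add[symmetric] exp_le_cancel_iff sq by (simp add: field_simps)
    have "norm (H F w u) = norm (F (w + u)) * ((1 + norm w) ^ m * exp (- Re (u * cnj w) - (norm w)\<^sup>2 / 2))"
      by (simp add: H_def norm_mult norm_power flip: of_real_add)
    also have "\<dots> \<le> norm (F (w + u)) * ((3 ^ m * (1 + norm (w + u)) ^ m) * (exp 2 * exp (- (norm (w + u))\<^sup>2 / 2)))"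
      using 1 2 by (intro mult_left_mono mult_mono) auto
    also have "\<dots> = K * (norm (F (w + u)) * exp (- psi m (w + u)))"
      by (simp add: K_def exp_minus_psi)
    finally show ?thesis .
  qed
  have Hint: "(\<integral>\<^sup>+z. ennreal (norm (H F w z) powr q) * indicator (cball 0 2) z \<partial>lborel)
      \<le> ennreal (K powr q) * (\<integral>\<^sup>+z. ennreal ((norm (F z) * exp (- psi m z)) powr q) * indicator (cball w 2) z \<partial>lborel)"
    if F: "F holomorphic_on UNIV" for F w
  proof -
    note [measurable] = entire_borel[OF F]
    let ?G = "\<lambda>z. ennreal ((norm (F z) * exp (- psi m z)) powr q) * indicator (cball w 2) z"
    have "(\<integral>\<^sup>+z. ennreal (norm (H F w z) powr q) * indicator (cball 0 2) z \<partial>lborel)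
        \<le> (\<integral>\<^sup>+z. ennreal (K powr q) * ?G (w + z) \<partial>lborel)"
    proof (rule nn_integral_mono)
      fix u
      have "norm (H F w u) powr q \<le> K powr q * (norm (F (w + u)) * exp (- psi m (w + u))) powr q" if "norm u \<le> 2"
      proof -
        have "norm (H F w u) powr q \<le> (K * (norm (F (w + u)) * exp (- psi m (w + u)))) powr q"
          using HK[OF that] q by (intro powr_mono2) auto
        then show ?thesis using K by (simp add: powr_mult)
      qed
      then show "ennreal (norm (H F w u) powr q) * indicator (cball 0 2) u \<le> ennreal (K powr q) * ?G (w + u)"
        by (auto simp: indicator_def dist_norm ennreal_mult'[symmetric] intro!: ennreal_leI)
    qed
    also have "\<dots> = (\<integral>\<^sup>+z. ennreal (K powr q) * ?G z \<partial>lborel)"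
      by (rule nn_integral_lborel_translate) auto
    also have "\<dots> = ennreal (K powr q) * (\<integral>\<^sup>+z. ?G z \<partial>lborel)"
      by (rule nn_integral_cmult) auto
    finally show ?thesis .
  qed
  have Hhol: "H F w holomorphic_on UNIV" if F: "F holomorphic_on UNIV" for F w
    unfolding H_def by (intro holomorphic_intros entire_translate F)
  \<comment> \<open>The product rule gives (H F w)'(0) as the weighted F'(w) minus
    \<open>cnj w\<close> times the weighted F(w). Solving for F'(w) leaves a sum with coefficients 1
    and |w|, hence the division by 1 + |w|.\<close>
  have H0': "norm (deriv F w) * exp (- psi m w) / (1 + norm w) \<le> max (norm (H F w 0)) (norm (deriv (H F w) 0))"
    if F: "F holomorphic_on UNIV" for F w
  proof -
    let ?c = "of_real ((1 + norm w) ^ m) * exp (- of_real ((norm w)\<^sup>2 / 2)) :: complex"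
    have c: "norm ?c = exp (- psi m w)"
      by (simp add: norm_mult exp_minus_psi norm_power flip: of_real_add)
    have "(F has_field_derivative deriv F (w + 0)) (at (w + 0))"
      using F holomorphic_derivI by blast
    then have "((\<lambda>u. F (w + u)) has_field_derivative deriv F w) (at 0)"
      using DERIV_shift[of F "deriv F w" 0 w] by (simp add: add.commute)
    then have "(H F w has_field_derivative (deriv F w * ?c + F w * (?c * (- cnj w)))) (at 0)"
      unfolding H_def
      by (auto intro!: derivative_eq_intros simp: algebra_simps)
    then have "deriv (H F w) 0 = deriv F w * ?c + F w * (?c * (- cnj w))"
      by (rule DERIV_imp_deriv)
    then have "deriv F w * ?c = deriv (H F w) 0 + F w * ?c * cnj w"
      by (simp add: algebra_simps)
    then have "norm (deriv F w) * exp (- psi m w) \<le> norm (deriv (H F w) 0) + norm (F w) * exp (- psi m w) * norm w"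
      by (metis c complex_mod_cnj norm_mult norm_triangle_ineq)
    also have "\<dots> = norm (deriv (H F w) 0) + norm (H F w 0) * norm w" by (simp add: H0)
    also have "\<dots> \<le> max (norm (H F w 0)) (norm (deriv (H F w) 0)) * (1 + norm w)"
      by (simp add: distrib_left add_mono mult_right_mono)
    finally show ?thesis by (simp add: divide_le_eq add_pos_nonneg)
  qed
  show thesis
  proof (rule that[of "C * K powr q"])
    show "C * K powr q > 0" using C K by simp
    fix F :: "complex \<Rightarrow> complex" and w assume F: "F holomorphic_on UNIV"
    let ?R = "ennreal (C * K powr q) * (\<integral>\<^sup>+z. ennreal ((norm (F z) * exp (- psi m z)) powr q) * indicator (cball w 2) z \<partial>lborel)"
    have R: "ennreal C * (\<integral>\<^sup>+z. ennreal (norm (H F w z) powr q) * indicator (cball 0 2) z \<partial>lborel) \<le> ?R"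
      using mult_left_mono[OF Hint[OF F, of w], of "ennreal C"] C(1) by (simp add: ennreal_mult' mult.assoc)
    have 0: "ennreal (norm (H F w 0) powr q) \<le> ?R" "ennreal (norm (deriv (H F w) 0) powr q) \<le> ?R"
      using C(2,3)[OF Hhol[OF F, of w]] R by (auto intro: order_trans)
    then show "ennreal ((norm (F w) * exp (- psi m w)) powr q) \<le> ?R" by (simp add: H0)
    have "ennreal ((norm (deriv F w) * exp (- psi m w) / (1 + norm w)) powr q) 
        \<le> ennreal (max (norm (H F w 0)) (norm (deriv (H F w) 0)) powr q)"
      using H0'[OF F, of w] q by (intro ennreal_leI powr_mono2) auto
    also have "\<dots> \<le> ?R" using 0 by (simp add: max_def)
    finally show "ennreal ((norm (deriv F w) * exp (- psi m w) / (1 + norm w)) powr q) \<le> ?R" .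
  qed
qed

section \<open>Integrability of the weight\<close>

text \<open>Where |z| has integer part k, the integrand is at most (1 + k)^(-4). Extending this
  constant to the disc of radius 1 + k, of area pi (1 + k)^2, leaves a convergent series of inverse
  squares.\<close>

lemma nn_integral_inverse_power4_finite:
  "(\<integral>\<^sup>+z. ennreal (1 / (1 + norm (z::complex)) ^ 4) \<partial>lborel) < \<infinity>"
proof -
  let ?c = "\<lambda>k::nat. 1 / (1 + real k) ^ 4"
  let ?f = "\<lambda>k (z::complex). ennreal (?c k) * indicator (cball 0 (1 + real k)) z"
  have "(\<integral>\<^sup>+z. ennreal (1 / (1 + norm (z::complex)) ^ 4) \<partial>lborel) \<le> (\<integral>\<^sup>+z. (\<Sum>k. ?f k z) \<partial>lborel)"
  proof (rule nn_integral_mono)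
    fix z :: complex
    define k where "k = nat \<lfloor>norm z\<rfloor>"
    have k: "real k \<le> norm z" "norm z \<le> 1 + real k"
      unfolding k_def by (auto simp: of_nat_nat) linarith+
    have "1 / (1 + norm z) ^ 4 \<le> ?c k"
      using k by (intro divide_left_mono power_mono mult_pos_pos zero_less_power) (auto simp: add_pos_nonneg)
    then have "ennreal (1 / (1 + norm z) ^ 4) \<le> ?f k z"
      using k by (auto simp: indicator_def intro!: ennreal_leI)
    also have "\<dots> \<le> (\<Sum>k. ?f k z)"
    proof -
      have "(\<Sum>k\<in>{k}. ?f k z) \<le> (\<Sum>k. ?f k z)" by (rule sum_le_suminf) auto
      then show ?thesis by (simp only: sum.insert finite.emptyI empty_iff not_False_eq_True sum.empty add_0_right)
    qed
    finally show "ennreal (1 / (1 + norm z) ^ 4) \<le> (\<Sum>k. ?f k z)" .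
  qed
  also have "\<dots> = (\<Sum>k. (\<integral>\<^sup>+z. ?f k z \<partial>lborel))"
    by (rule nn_integral_suminf) auto
  also have "\<dots> = (\<Sum>k. ennreal (pi * inverse (real (Suc k) ^ 2)))"
  proof (intro suminf_cong)
    fix k
    have "(\<integral>\<^sup>+z. ?f k z \<partial>lborel) = ennreal (?c k) * ennreal (pi * (1 + real k)\<^sup>2)"
      by (subst nn_integral_cmult) (auto simp: emeasure_complex_cball)
    also have "\<dots> = ennreal (pi * inverse (real (Suc k) ^ 2))"
      by (subst ennreal_mult'[symmetric])
         (auto simp: power2_eq_square power4_eq_xxxx divide_simps)
    finally show "(\<integral>\<^sup>+z. ?f k z \<partial>lborel) = ennreal (pi * inverse (real (Suc k) ^ 2))" .
  qed
  also have "\<dots> < \<infinity>"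
  proof -
    have "summable (\<lambda>k. inverse (real k ^ 2))" by (rule inverse_power_summable) auto
    then have "summable (\<lambda>k. inverse (real (Suc k) ^ 2))"
      by (subst summable_Suc_iff)
    then have "summable (\<lambda>k. pi * inverse (real (Suc k) ^ 2))" by (rule summable_mult)
    then show ?thesis by (subst suminf_ennreal2) auto
  qed
  finally show ?thesis .
qed

lemma fock_integral_const_finite:
  assumes p: "0 < p" shows "fock_integral p m (\<lambda>_. c) < \<infinity>"
proof -
  \<comment> \<open>The total coefficient of ln (1 + r) once the decay (1 + r)^(-4) is also
    demanded. After ln (1 + r) is replaced by r, completing the square bounds b r - p r^2 / 2 by b^2
    / (2 p).\<close>
  define b where "b = p * real m + 4"
  define K where "K = norm c powr p * exp (b\<^sup>2 / (2 * p))"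
  have "norm c powr p * exp (- p * psi m z) \<le> K * (1 / (1 + norm z) ^ 4)" for z
  proof -
    let ?r = "norm z"
    have r: "?r \<ge> 0" by simp
    have pow: "(1 + ?r) ^ 4 = exp (4 * ln (1 + ?r))"
      using exp_of_nat_mult[of 4 "ln (1 + ?r)"] r by (simp add: add_pos_nonneg)
    have "0 \<le> (p * ?r - b)\<^sup>2 / (2 * p)" using p by simp
    also have "\<dots> = p * ?r\<^sup>2 / 2 - b * ?r + b\<^sup>2 / (2 * p)"
      using p by (simp add: power2_eq_square field_simps)
    finally have 1: "b * ?r - p * ?r\<^sup>2 / 2 \<le> b\<^sup>2 / (2 * p)" by simp
    have "b * ln (1 + ?r) \<le> b * ?r"
      using p ln_add_one_self_le_self[OF r] by (intro mult_left_mono) (auto simp: b_def)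
    with 1 have "- p * psi m z + 4 * ln (1 + ?r) \<le> b\<^sup>2 / (2 * p)"
      by (simp add: psi_def b_def algebra_simps)
    then have "exp (- p * psi m z) * (1 + ?r) ^ 4 \<le> exp (b\<^sup>2 / (2 * p))"
      unfolding pow exp_add[symmetric] by simp
    then have "norm c powr p * (exp (- p * psi m z) * (1 + ?r) ^ 4) \<le> K"
      unfolding K_def by (rule mult_left_mono) simp
    then show ?thesis
      using pos_le_divide_eq[of "(1 + ?r) ^ 4" "norm c powr p * exp (- p * psi m z)" K] r
      by (simp add: mult.assoc add_pos_nonneg)
  qed
  then have "fock_integral p m (\<lambda>_. c) \<le> (\<integral>\<^sup>+z. ennreal K * ennreal (1 / (1 + norm (z::complex)) ^ 4) \<partial>lborel)"
    unfolding fock_integral_def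
    by (intro nn_integral_mono) (auto simp: K_def ennreal_mult'[symmetric] intro!: ennreal_leI)
  also have "\<dots> = ennreal K * (\<integral>\<^sup>+z. ennreal (1 / (1 + norm (z::complex)) ^ 4) \<partial>lborel)"
    by (rule nn_integral_cmult) auto
  also have "\<dots> < \<infinity>"
    using nn_integral_inverse_power4_finite by (simp add: ennreal_mult_less_top)
  finally show ?thesis .
qed

section \<open>Linear structure and the quasi-norm\<close>

text \<open>The two sides may carry different weights, so that a power of |z| can be traded for a
  larger \<open>m\<close>.\<close>

lemma fock_integral_mono:
  assumes "\<And>z. norm (f z) * exp (- psi m z) \<le> norm (g z) * exp (- psi n z)" and "0 \<le> p"
  shows "fock_integral p m f \<le> fock_integral p n g"
  unfolding fock_integral_alt
  using assms by (intro nn_integral_mono ennreal_leI powr_mono2) auto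

text \<open>The factor \<open>2 powr p\<close>, from |a + b| at most 2 max(|a|, |b|), lets one
  estimate cover p below 1, where the triangle inequality for the norm fails, as well as p at least
  1.\<close>

lemma fock_integral_add_le:
  assumes [measurable]: "f \<in> borel_measurable borel" "g \<in> borel_measurable borel" and p: "0 < p"
  shows "fock_integral p m (\<lambda>z. f z + g z) \<le> ennreal (2 powr p) * (fock_integral p m f + fock_integral p m g)"
proof -
  have bound: "norm (a + b) powr p \<le> 2 powr p * (norm a powr p + norm b powr p)" for a b :: complex
  proof -
    have "norm (a + b) \<le> 2 * max (norm a) (norm b)"
      using norm_triangle_ineq[of a b] by linarith
    then have "norm (a + b) powr p \<le> (2 * max (norm a) (norm b)) powr p"
      using p by (intro powr_mono2) auto
    also have "\<dots> = 2 powr p * max (norm a) (norm b) powr p" by (simp add: powr_mult)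
    also have "\<dots> \<le> 2 powr p * (norm a powr p + norm b powr p)"
      by (intro mult_left_mono) (auto simp: max_def)
    finally show ?thesis .
  qed
  have *: "norm (f z + g z) powr p * exp (- p * psi m z)
      \<le> 2 powr p * (norm (f z) powr p * exp (- p * psi m z) + norm (g z) powr p * exp (- p * psi m z))" for z
  proof -
    have "norm (f z + g z) powr p * exp (- p * psi m z)
        \<le> (2 powr p * (norm (f z) powr p + norm (g z) powr p)) * exp (- p * psi m z)"
      by (rule mult_right_mono[OF bound]) simp
    then show ?thesis by (simp only: distrib_left distrib_right mult.assoc)
  qed
  have "fock_integral p m (\<lambda>z. f z + g z) \<le> (\<integral>\<^sup>+z. ennreal (2 powr p) *
      (ennreal (norm (f z) powr p * exp (- p * psi m z)) + ennreal (norm (g z) powr p * exp (- p * psi m z))) \<partial>lborel)"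
    unfolding fock_integral_def
    using * by (intro nn_integral_mono) (auto simp: ennreal_mult'[symmetric] ennreal_plus[symmetric] simp del: ennreal_plus intro!: ennreal_leI)
  also have "\<dots> = ennreal (2 powr p) * (fock_integral p m f + fock_integral p m g)"
    unfolding fock_integral_def by (simp add: nn_integral_cmult nn_integral_add)
  finally show ?thesis .
qed

lemma fock_integral_cmult:
  assumes [measurable]: "f \<in> borel_measurable borel"
  shows "fock_integral p m (\<lambda>z. c * f z) = ennreal (norm c powr p) * fock_integral p m f"
proof -
  have "fock_integral p m (\<lambda>z. c * f z) = (\<integral>\<^sup>+z. ennreal (norm c powr p) * ennreal (norm (f z) powr p * exp (- p * psi m z)) \<partial>lborel)"
    unfolding fock_integral_def
    by (intro nn_integral_cong) (simp add: norm_mult powr_mult mult.assoc ennreal_mult')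
  then show ?thesis unfolding fock_integral_def by (simp add: nn_integral_cmult)
qed

lemma fock_space_cmult:
  assumes "f \<in> fock_space p m" shows "(\<lambda>z. c * f z) \<in> fock_space p m"
  using assms by (auto simp: fock_space_def fock_integral_cmult entire_borel ennreal_mult_less_top
      intro!: holomorphic_intros)

lemma fock_space_add:
  assumes "f \<in> fock_space p m" "g \<in> fock_space p m" "0 < p"
  shows "(\<lambda>z. f z + g z) \<in> fock_space p m"
proof -
  have "fock_integral p m (\<lambda>z. f z + g z) \<le> ennreal (2 powr p) * (fock_integral p m f + fock_integral p m g)"
    using assms by (intro fock_integral_add_le) (auto simp: fock_space_def entire_borel)
  also have "\<dots> < \<infinity>"
    using assms by (auto simp: fock_space_def ennreal_mult_less_top)
  finally show ?thesis using assms by (auto simp: fock_space_def intro!: holomorphic_intros)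
qed

lemma fock_space_diff:
  assumes "f \<in> fock_space p m" "g \<in> fock_space p m" "0 < p"
  shows "(\<lambda>z. f z - g z) \<in> fock_space p m"
  using fock_space_add[OF assms(1) fock_space_cmult[OF assms(2), of "-1"] assms(3)] by simp

lemma fock_space_const: "0 < p \<Longrightarrow> (\<lambda>_. c) \<in> fock_space p m"
  using fock_integral_const_finite[of p m c] by (simp add: fock_space_def)

lemma fock_norm_nonneg: "0 \<le> fock_norm p m f"
  by (simp add: fock_norm_def)

text \<open>Membership provides finiteness: \<open>enn2real\<close> sends infinity to 0, so outside
  the space \<open>fock_norm\<close> would carry no information.\<close>

lemma fock_integral_eq_norm_powr:
  assumes "f \<in> fock_space p m" "0 < p"
  shows "fock_integral p m f = ennreal (fock_norm p m f powr p)"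
  using assms by (cases "fock_integral p m f") (auto simp: fock_space_def fock_norm_def powr_powr)

lemma fock_norm_le:
  assumes "fock_integral p m f \<le> ennreal (B powr p)" "0 < p" "0 \<le> B"
  shows "fock_norm p m f \<le> B"
proof -
  have "enn2real (fock_integral p m f) \<le> B powr p"
    using enn2real_mono[OF assms(1)] by simp
  then have "fock_norm p m f \<le> (B powr p) powr (1 / p)"
    unfolding fock_norm_def using assms by (intro powr_mono2) auto
  also have "\<dots> = B" using assms by (simp add: powr_powr)
  finally show ?thesis .
qed

lemma fock_norm_zero: "fock_norm p m (\<lambda>_. 0) = 0"
  by (simp add: fock_norm_def fock_integral_def)

section \<open>Global evaluation bounds and the inclusion for p at most q\<close>

text \<open>The disc in the local estimate is enlarged to the whole plane and the q-th root is
  taken.\<close>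

lemma fock_pointwise_norm:
  assumes q: "0 < (q::real)"
  obtains C where "C > 0"
    "\<And>F w. F \<in> fock_space q m \<Longrightarrow> norm (F w) * exp (- psi m w) \<le> C * fock_norm q m F"
    "\<And>F w. F \<in> fock_space q m \<Longrightarrow> norm (deriv F w) * exp (- psi m w) / (1 + norm w) \<le> C * fock_norm q m F"
proof -
  obtain C where C: "C > 0"
    "\<And>F w. F holomorphic_on UNIV \<Longrightarrow>
      ennreal ((norm (F w) * exp (- psi m w)) powr q)
      \<le> ennreal C * (\<integral>\<^sup>+z. ennreal ((norm (F z) * exp (- psi m z)) powr q) * indicator (cball w 2) z \<partial>lborel)"
    "\<And>F w. F holomorphic_on UNIV \<Longrightarrow>
      ennreal ((norm (deriv F w) * exp (- psi m w) / (1 + norm w)) powr q)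
      \<le> ennreal C * (\<integral>\<^sup>+z. ennreal ((norm (F z) * exp (- psi m z)) powr q) * indicator (cball w 2) z \<partial>lborel)"
    using fock_pointwise[OF q] by blast
  have key: "x \<le> C powr (1/q) * fock_norm q m F"
    if F: "F \<in> fock_space q m" and x: "0 \<le> x" and
      le: "ennreal (x powr q) \<le> ennreal C * (\<integral>\<^sup>+z. ennreal ((norm (F z) * exp (- psi m z)) powr q) * indicator (cball w 2) z \<partial>lborel)"
    for F x w
  proof -
    have "(\<integral>\<^sup>+z. ennreal ((norm (F z) * exp (- psi m z)) powr q) * indicator (cball w 2) z \<partial>lborel) \<le> fock_integral q m F"
      unfolding fock_integral_alt by (intro nn_integral_mono) (auto simp: indicator_def)
    with le have "ennreal (x powr q) \<le> ennreal C * fock_integral q m F"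
      by (meson mult_left_mono order_trans zero_le)
    also have "\<dots> = ennreal (C * fock_norm q m F powr q)"
      using C(1) by (simp add: fock_integral_eq_norm_powr[OF F q] ennreal_mult')
    finally have "x powr q \<le> C * fock_norm q m F powr q"
      using C(1) by (subst (asm) ennreal_le_iff) auto
    then have "(x powr q) powr (1/q) \<le> (C * fock_norm q m F powr q) powr (1/q)"
      using q by (intro powr_mono2) auto
    then show ?thesis using q x C(1) by (simp add: powr_powr powr_mult fock_norm_nonneg)
  qed
  show thesis
  proof (rule that[of "C powr (1/q)"])
    fix F w assume F: "F \<in> fock_space q m"
    then have hol: "F holomorphic_on UNIV" by (simp add: fock_space_def)
    show "norm (F w) * exp (- psi m w) \<le> C powr (1/q) * fock_norm q m F"
      by (rule key[OF F _ C(2)[OF hol]]) auto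
    show "norm (deriv F w) * exp (- psi m w) / (1 + norm w) \<le> C powr (1/q) * fock_norm q m F"
      by (rule key[OF F _ C(3)[OF hol]]) auto
  qed (use C(1) in auto)
qed

text \<open>Splits x^q = x^(q-p) x^p and bounds the first factor by the supremum. It serves the
  inclusion below and, with the exponents exchanged, the monomials in the case q < p.\<close>

lemma fock_integral_interpolate:
  assumes [measurable]: "f \<in> borel_measurable borel" and pq: "0 < p" "p \<le> q"
    and S: "\<And>z. norm (f z) * exp (- psi m z) \<le> S"
  shows "fock_integral q m f \<le> ennreal (S powr (q - p)) * fock_integral p m f"
proof -
  have "fock_integral q m f \<le> (\<integral>\<^sup>+z. ennreal (S powr (q - p)) * ennreal ((norm (f z) * exp (- psi m z)) powr p) \<partial>lborel)"
    unfolding fock_integral_alt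
  proof (rule nn_integral_mono)
    fix z
    let ?x = "norm (f z) * exp (- psi m z)"
    have "?x powr q = ?x powr (q - p) * ?x powr p" by (simp flip: powr_add)
    also have "\<dots> \<le> S powr (q - p) * ?x powr p"
      using S[of z] pq by (intro mult_right_mono powr_mono2) auto
    finally show "ennreal (?x powr q) \<le> ennreal (S powr (q - p)) * ennreal (?x powr p)"
      by (simp add: ennreal_mult'[symmetric] ennreal_leI)
  qed
  also have "\<dots> = ennreal (S powr (q - p)) * fock_integral p m f"
    unfolding fock_integral_alt by (rule nn_integral_cmult) auto
  finally show ?thesis .
qed

lemma fock_space_embedding:
  assumes pq: "0 < p" "p \<le> q"
  obtains C where "C > 0" "\<And>f. f \<in> fock_space p m \<Longrightarrow> f \<in> fock_space q m"
    "\<And>f. f \<in> fock_space p m \<Longrightarrow> fock_norm q m f \<le> C * fock_norm p m f"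
proof -
  obtain C where C: "C > 0" 
    "\<And>F w. F \<in> fock_space p m \<Longrightarrow> norm (F w) * exp (- psi m w) \<le> C * fock_norm p m F"
    using fock_pointwise_norm[OF pq(1)] by metis
  \<comment> \<open>The q-th root of the factor \<open>C powr (q - p)\<close> that appears when the
    supremum in the interpolation is \<open>C\<close> times the p-norm.\<close>
  define K where "K = C powr ((q - p) / q)"
  have le: "fock_integral q m f \<le> ennreal ((K * fock_norm p m f) powr q)" if f: "f \<in> fock_space p m" for f
  proof -
    let ?N = "fock_norm p m f"
    have "fock_integral q m f \<le> ennreal ((C * ?N) powr (q - p)) * fock_integral p m f"
      using f C pq by (intro fock_integral_interpolate) (auto simp: fock_space_def entire_borel)
    also have "\<dots> = ennreal ((C * ?N) powr (q - p) * ?N powr p)"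
      by (simp add: fock_integral_eq_norm_powr[OF f pq(1)] ennreal_mult')
    also have "(C * ?N) powr (q - p) * ?N powr p = (K * ?N) powr q"
      using pq C(1) fock_norm_nonneg[of p m f] by (simp add: K_def powr_mult powr_powr mult.assoc flip: powr_add)
    finally show ?thesis .
  qed
  show thesis
  proof (rule that[of K])
    show "K > 0" using C by (simp add: K_def)
    fix f assume f: "f \<in> fock_space p m"
    show "f \<in> fock_space q m" using le[OF f] f by (auto simp: fock_space_def less_top[symmetric] top_unique)
    show "fock_norm q m f \<le> K * fock_norm p m f"
      using le[OF f] pq by (intro fock_norm_le) (auto simp: K_def fock_norm_nonneg)
  qed
qed

section \<open>The operators\<close>

lemma volterra_primitive:
  assumes f: "f holomorphic_on UNIV" and g: "g holomorphic_on UNIV"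
  shows "volterra g f holomorphic_on UNIV" "deriv (volterra g f) w = deriv f w * g w"
proof -
  have "(\<lambda>w. deriv f w * g w) holomorphic_on UNIV"
    using f g by (intro holomorphic_intros) auto
  then obtain G where G: "\<And>x. (G has_field_derivative deriv f x * g x) (at x)"
    using holomorphic_convex_primitive'[of UNIV "\<lambda>w. deriv f w * g w"] by auto
  have "volterra g f z = G z - G 0" for z
    unfolding volterra_def
    using contour_integral_primitive[of UNIV G "\<lambda>w. deriv f w * g w" "linepath 0 z"] G
    by (auto intro!: contour_integral_unique intro: has_field_derivative_at_within)
  then have eq: "volterra g f = (\<lambda>z. G z - G 0)" by auto
  have D: "(volterra g f has_field_derivative deriv f z * g z) (at z)" for z
    unfolding eq by (auto intro!: derivative_eq_intros G)
  show "deriv (volterra g f) w = deriv f w * g w"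
    by (rule DERIV_imp_deriv[OF D])
  show "volterra g f holomorphic_on UNIV"
    using D by (auto simp: holomorphic_on_def field_differentiable_def intro: has_field_derivative_at_within)
qed

lemma volterra_const:
  assumes f: "f holomorphic_on UNIV"
  shows "volterra (\<lambda>_. c) f = (\<lambda>z. c * (f z - f 0))"
proof
  fix z
  have "((\<lambda>z. c * f z) has_field_derivative deriv f x * c) (at x within UNIV)" for x
  proof -
    have "(f has_field_derivative deriv f x) (at x)"
      using f holomorphic_derivI by blast
    then show ?thesis by (auto intro!: derivative_eq_intros)
  qed
  from contour_integral_unique[OF contour_integral_primitive[OF this, of "linepath 0 z"]]
  show "volterra (\<lambda>_. c) f z = c * (f z - f 0)"
    unfolding volterra_def by (simp add: algebra_simps)
qed

section \<open>Kernel test functions and the necessary conditions\<close>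

text \<open>The normalised kernel exp(z \<open>cnj w\<close> - |w|^2 / 2) times the Gaussian has
  modulus exp(-|z - w|^2 / 2), a translate of the Gaussian. Hence its norm is controlled by that of
  a constant function, uniformly in \<open>w\<close>, while its weighted derivative at
  \<open>w\<close> grows like |w|.\<close>

lemma fock_test_functions:
  assumes p: "0 < p"
  obtains \<kappa> where "\<kappa> > 0" "\<And>w. \<exists>f \<in> fock_space p m. fock_norm p m f \<le> 1 \<and> norm (deriv f w) * exp (- psi m w) = \<kappa> * norm w"
proof -
  define N where "N = fock_norm p m (\<lambda>_. 1)"
  \<comment> \<open>The summand 1 makes the denominator positive from \<open>N \<ge> 0\<close>
    alone, and \<open>\<kappa> * N \<le> 1\<close> still holds.\<close>
  define \<kappa> where "\<kappa> = 1 / (N + 1)"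
  have N: "N \<ge> 0" by (simp add: N_def fock_norm_nonneg)
  then have \<kappa>: "\<kappa> > 0" "\<kappa> * N \<le> 1" by (auto simp: \<kappa>_def)
  have "\<exists>f \<in> fock_space p m. fock_norm p m f \<le> 1 \<and> norm (deriv f w) * exp (- psi m w) = \<kappa> * norm w" for w
  proof -
    \<comment> \<open>The polynomial part of the weight is not translation invariant. Dividing by (1
      + |w|)^m compensates through 1 + |z| at most (1 + |w|)(1 + |z - w|).\<close>
    define c where "c = \<kappa> / (1 + norm w) ^ m"
    define f where "f = (\<lambda>z. of_real c * exp (z * cnj w - of_real ((norm w)\<^sup>2 / 2)))"
    have c: "c > 0" using \<kappa> by (simp add: c_def add_pos_nonneg)
    have hol: "f holomorphic_on UNIV" unfolding f_def by (intro holomorphic_intros)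
    have le: "norm (f z) * exp (- psi m z) \<le> \<kappa> * exp (- psi m (- w + z))" for z
    proof -
      let ?u = "- w + z"
      have "(norm ?u)\<^sup>2 = (norm z)\<^sup>2 - 2 * Re (z * cnj w) + (norm w)\<^sup>2"
        by (simp add: cmod_power2) (simp add: power2_eq_square algebra_simps)
      then have e: "Re (z * cnj w) - (norm w)\<^sup>2 / 2 + - (norm z)\<^sup>2 / 2 = - (norm ?u)\<^sup>2 / 2"
        by (simp add: field_simps)
      have "norm z \<le> norm w + norm ?u"
        using norm_triangle_ineq[of w ?u] by simp
      moreover have "(1 + norm w) * (1 + norm ?u) = 1 + norm w + norm ?u + norm w * norm ?u"
        by (simp add: algebra_simps)
      moreover have "0 \<le> norm w * norm ?u" by simp
      ultimately have "1 + norm z \<le> (1 + norm w) * (1 + norm ?u)" by linarith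
      then have "(1 + norm z) ^ m \<le> (1 + norm w) ^ m * (1 + norm ?u) ^ m"
        by (metis add_nonneg_nonneg norm_ge_zero power_mono power_mult_distrib zero_le_one)
      then have "c * (1 + norm z) ^ m \<le> c * ((1 + norm w) ^ m * (1 + norm ?u) ^ m)"
        using c by (intro mult_left_mono) auto
      also have "\<dots> = \<kappa> * (1 + norm ?u) ^ m"
        by (simp add: c_def add_nonneg_eq_0_iff)
      finally have *: "c * (1 + norm z) ^ m \<le> \<kappa> * (1 + norm ?u) ^ m" .
      have "norm (f z) * exp (- psi m z)
          = (c * exp (Re (z * cnj w) - (norm w)\<^sup>2 / 2)) * ((1 + norm z) ^ m * exp (- (norm z)\<^sup>2 / 2))"
        using c by (simp add: f_def norm_mult exp_minus_psi)
      also have "\<dots> = (c * (1 + norm z) ^ m) * exp (Re (z * cnj w) - (norm w)\<^sup>2 / 2 + - (norm z)\<^sup>2 / 2)"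
        by (simp only: exp_add mult_ac)
      also have "\<dots> = (c * (1 + norm z) ^ m) * exp (- (norm ?u)\<^sup>2 / 2)"
        by (simp only: e)
      also have "\<dots> \<le> (\<kappa> * (1 + norm ?u) ^ m) * exp (- (norm ?u)\<^sup>2 / 2)"
        using * by (rule mult_right_mono) simp
      also have "\<dots> = \<kappa> * exp (- psi m ?u)" by (simp add: exp_minus_psi mult.assoc)
      finally show ?thesis .
    qed
    have "fock_integral p m f \<le> (\<integral>\<^sup>+z. ennreal ((\<kappa> * exp (- psi m (- w + z))) powr p) \<partial>lborel)"
      unfolding fock_integral_alt using le p by (intro nn_integral_mono ennreal_leI powr_mono2) auto
    also have "\<dots> = (\<integral>\<^sup>+z. ennreal ((\<kappa> * exp (- psi m z)) powr p) \<partial>lborel)"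
      by (rule nn_integral_lborel_translate[where f = "\<lambda>z. ennreal ((\<kappa> * exp (- psi m z)) powr p)"]) auto
    also have "\<dots> = fock_integral p m (\<lambda>z. of_real \<kappa> * 1)"
      using \<kappa> by (simp add: fock_integral_alt)
    also have "\<dots> = ennreal (\<kappa> powr p) * ennreal (N powr p)"
      using \<kappa> p unfolding N_def
      by (subst fock_integral_cmult) (auto simp: fock_integral_eq_norm_powr fock_space_const)
    also have "\<dots> = ennreal ((\<kappa> * N) powr p)"
      using \<kappa> N by (simp add: powr_mult ennreal_mult')
    also have "\<dots> \<le> ennreal (1 powr p)"
      using \<kappa> N p by (intro ennreal_leI powr_mono2) auto
    finally have int: "fock_integral p m f \<le> ennreal (1 powr p)" .
    have "(f has_field_derivative (of_real c * (exp (w * cnj w - of_real ((norm w)\<^sup>2 / 2)) * cnj w))) (at w)"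
      unfolding f_def by (auto intro!: derivative_eq_intros)
    then have "deriv f w = of_real c * (exp (w * cnj w - of_real ((norm w)\<^sup>2 / 2)) * cnj w)"
      by (rule DERIV_imp_deriv)
    moreover have "Re (w * cnj w - of_real ((norm w)\<^sup>2 / 2)) = (norm w)\<^sup>2 / 2"
    proof -
      have "Re (w * cnj w) = (norm w)\<^sup>2"
        by (simp add: cmod_power2) (simp add: power2_eq_square)
      then show ?thesis unfolding minus_complex.sel Re_complex_of_real by linarith
    qed
    ultimately have "norm (deriv f w) = c * exp ((norm w)\<^sup>2 / 2) * norm w"
      using c by (simp add: norm_mult)
    then have "norm (deriv f w) * exp (- psi m w) = (c * (1 + norm w) ^ m) * norm w * (exp ((norm w)\<^sup>2 / 2) * exp (- (norm w)\<^sup>2 / 2))"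
      by (simp add: exp_minus_psi)
    also have "\<dots> = \<kappa> * norm w"
      by (simp add: c_def add_nonneg_eq_0_iff flip: exp_add)
    finally have "norm (deriv f w) * exp (- psi m w) = \<kappa> * norm w" .
    moreover have "f \<in> fock_space p m"
      using hol int by (auto simp: fock_space_def less_top[symmetric] top_unique)
    moreover have "fock_norm p m f \<le> 1"
      using int p by (intro fock_norm_le) auto
    ultimately show ?thesis by blast
  qed
  with \<kappa>(1) show thesis using that by blast
qed

text \<open>In the derivative estimate at \<open>w\<close>, the growth |w| of the test function
  cancels the loss 1 + |w|, so what remains is a bound for |g(w)| itself.\<close>

lemma volterra_bounded_imp_constant:
  assumes g: "g holomorphic_on UNIV" and p: "0 < p" and q: "0 < q" and bdd: "volterra_bounded m g p q"
  shows "g z = g 0"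
proof -
  obtain \<kappa> where \<kappa>: "\<kappa> > 0" "\<And>w. \<exists>f \<in> fock_space p m. fock_norm p m f \<le> 1 \<and> norm (deriv f w) * exp (- psi m w) = \<kappa> * norm w"
    using fock_test_functions[OF p] by blast
  obtain C where C: "C > 0"
    "\<And>F w. F \<in> fock_space q m \<Longrightarrow> norm (deriv F w) * exp (- psi m w) / (1 + norm w) \<le> C * fock_norm q m F"
    using fock_pointwise_norm[OF q] by metis
  obtain D where D: "\<And>f. f \<in> fock_space p m \<Longrightarrow> fock_norm q m (volterra g f) \<le> D * fock_norm p m f"
    using bdd by (auto simp: volterra_bounded_def)
  have "norm (g w) \<le> 2 * C * \<bar>D\<bar> / \<kappa>" if w: "1 \<le> norm w" for w
  proof -
    obtain f where f: "f \<in> fock_space p m" "fock_norm p m f \<le> 1" "norm (deriv f w) * exp (- psi m w) = \<kappa> * norm w"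
      using \<kappa>(2) by blast
    have "fock_norm q m (volterra g f) \<le> D * fock_norm p m f" by (rule D[OF f(1)])
    also have "\<dots> \<le> \<bar>D\<bar> * 1"
      using f(2) by (intro mult_mono) (auto simp: fock_norm_nonneg)
    finally have n: "fock_norm q m (volterra g f) \<le> \<bar>D\<bar>" by simp
    have "norm (deriv (volterra g f) w) * exp (- psi m w) / (1 + norm w) \<le> C * fock_norm q m (volterra g f)"
      using bdd f(1) by (intro C(2)) (auto simp: volterra_bounded_def)
    also have "\<dots> \<le> C * \<bar>D\<bar>" using n C(1) by simp
    also have "norm (deriv (volterra g f) w) * exp (- psi m w) = norm (g w) * (\<kappa> * norm w)"
      using f by (simp add: volterra_primitive(2)[OF _ g] fock_space_def norm_mult flip: f(3))
    finally have "norm (g w) * (\<kappa> * norm w) \<le> C * \<bar>D\<bar> * (1 + norm w)"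
      by (simp add: divide_le_eq add_pos_nonneg)
    also have "\<dots> \<le> C * \<bar>D\<bar> * (2 * norm w)"
      using w C(1) by (intro mult_left_mono) auto
    finally have "norm w * (norm (g w) * \<kappa>) \<le> norm w * (2 * C * \<bar>D\<bar>)"
      by (simp add: mult_ac)
    then have "norm (g w) * \<kappa> \<le> 2 * C * \<bar>D\<bar>" using w by (subst (asm) mult_le_cancel_left_pos) auto
    then show ?thesis using \<kappa>(1) by (simp add: pos_le_divide_eq)
  qed
  \<comment> \<open>The polynomial form of Liouville's theorem in degree 0 accepts a bound that
    holds only for |w| at least 1.\<close>
  then show ?thesis
    using Liouville_polynomial[OF g, of 1 "2 * C * \<bar>D\<bar> / \<kappa>" 0 z] by simp
qed

text \<open>The local integrals run over discs that escape to infinity, so the integrand on them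
  tends to 0 pointwise and is dominated by the full integrand of the norm of
  \<open>h\<close>.\<close>

lemma fock_deriv_decay:
  assumes h: "h \<in> fock_space q m" and q: "0 < q" and w: "\<And>n. real n \<le> norm (w n)"
  shows "(\<lambda>n. norm (deriv h (w n)) * exp (- psi m (w n)) / (1 + norm (w n))) \<longlonglongrightarrow> 0"
proof -
  have hol: "h holomorphic_on UNIV" using h by (simp add: fock_space_def)
  note [measurable] = entire_borel[OF hol]
  let ?W = "\<lambda>z. ennreal ((norm (h z) * exp (- psi m z)) powr q)"
  let ?\<tau> = "\<lambda>n. norm (deriv h (w n)) * exp (- psi m (w n)) / (1 + norm (w n))"
  obtain C where C0: "C > 0" and C': "\<And>F w. F holomorphic_on UNIV \<Longrightarrow>
      ennreal ((norm (deriv F w) * exp (- psi m w) / (1 + norm w)) powr q)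
      \<le> ennreal C * (\<integral>\<^sup>+z. ennreal ((norm (F z) * exp (- psi m z)) powr q) * indicator (cball w 2) z \<partial>lborel)"
    by (rule fock_pointwise[OF q, of m], rule that)
  note C = C0 C'[OF hol]
  have "(\<lambda>n. \<integral>\<^sup>+z. ?W z * indicator (cball (w n) 2) z \<partial>lborel) \<longlonglongrightarrow> (\<integral>\<^sup>+z. (0::ennreal) \<partial>(lborel::complex measure))"
  proof (rule nn_integral_dominated_convergence[where w = ?W])
    show "(\<integral>\<^sup>+z. ?W z \<partial>lborel) < \<infinity>" using h by (simp add: fock_space_def fock_integral_alt)
    show "AE z in lborel. (\<lambda>n. ?W z * indicator (cball (w n) 2) z) \<longlonglongrightarrow> 0"
    proof (rule AE_I2)
      fix z :: complex
      have "eventually (\<lambda>n. real n > norm z + 2) sequentially"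
        using filterlim_real_sequentially by (auto simp: filterlim_at_top_dense)
      then have "eventually (\<lambda>n. ?W z * indicator (cball (w n) 2) z = 0) sequentially"
      proof eventually_elim
        case (elim n)
        then have "norm z + 2 < norm (w n)" using w[of n] by linarith
        also have "\<dots> \<le> norm z + dist (w n) z"
          using norm_triangle_ineq[of z "w n - z"] by (simp add: dist_norm)
        finally show ?case by simp
      qed
      then show "(\<lambda>n. ?W z * indicator (cball (w n) 2) z) \<longlonglongrightarrow> 0"
        by (rule tendsto_eventually)
    qed
  qed (auto simp: indicator_def)
  from ennreal_tendsto_cmult[OF _ this, of "ennreal C"]
  have lim: "(\<lambda>n. ennreal C * (\<integral>\<^sup>+z. ?W z * indicator (cball (w n) 2) z \<partial>lborel)) \<longlonglongrightarrow> 0"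
    by simp
  have "(\<lambda>n. ennreal (?\<tau> n powr q)) \<longlonglongrightarrow> 0"
    by (rule tendsto_sandwich[OF _ _ tendsto_const lim]) (use C in auto)
  then have "(\<lambda>n. ?\<tau> n powr q) \<longlonglongrightarrow> 0"
    by (subst (asm) ennreal_tendsto_0_iff) auto
  from tendsto_zero_powrI[OF this tendsto_const, of "1 / q"]
  have "(\<lambda>n. (?\<tau> n powr q) powr (1 / q)) \<longlonglongrightarrow> 0"
    using q by simp
  then show ?thesis using q by (simp add: powr_powr)
qed

text \<open>If |g| stays above \<open>e\<close> along points going to infinity, kernels at these
  points have images whose weighted derivatives there stay bounded below. A norm limit
  \<open>h\<close> of a subsequence would inherit this, against the decay of its own weighted
  derivative.\<close>

lemma volterra_compact_imp_zero:
  assumes g: "g holomorphic_on UNIV" and p: "0 < p" and q: "0 < q" and cpt: "volterra_compact m g p q"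
  shows "g z = 0"
proof (rule Liouville_weak_0[OF g], rule ccontr)
  assume "\<not> (g \<longlongrightarrow> 0) at_infinity"
  then obtain e where e: "e > 0" "\<And>b. \<exists>x. b \<le> norm x \<and> e \<le> norm (g x)"
    unfolding Lim_at_infinity by (auto simp: not_less)
  \<comment> \<open>The shift by 1 gives norm at least 1 for every \<open>n\<close>, hence |w| / (1
    + |w|) at least 1/2 later on.\<close>
  then have "\<forall>n::nat. \<exists>x. real n + 1 \<le> norm x \<and> e \<le> norm (g x)" by blast
  then obtain w where w: "\<And>n::nat. real n + 1 \<le> norm (w n)" "\<And>n. e \<le> norm (g (w n))" by metis
  obtain \<kappa> where \<kappa>: "\<kappa> > 0" "\<And>w. \<exists>f \<in> fock_space p m. fock_norm p m f \<le> 1 \<and> norm (deriv f w) * exp (- psi m w) = \<kappa> * norm w"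
    using fock_test_functions[OF p] by blast
  then have "\<forall>n. \<exists>f. f \<in> fock_space p m \<and> fock_norm p m f \<le> 1 \<and>
      norm (deriv f (w n)) * exp (- psi m (w n)) = \<kappa> * norm (w n)" by blast
  from choice[OF this] obtain f where f: "\<And>n. f n \<in> fock_space p m" "\<And>n. fock_norm p m (f n) \<le> 1"
    "\<And>n. norm (deriv (f n) (w n)) * exp (- psi m (w n)) = \<kappa> * norm (w n)" by blast
  obtain C where C: "C > 0"
    "\<And>F w. F \<in> fock_space q m \<Longrightarrow> norm (deriv F w) * exp (- psi m w) / (1 + norm w) \<le> C * fock_norm q m F"
    using fock_pointwise_norm[OF q] by metis
  obtain r h where r: "strict_mono r" and h: "h \<in> fock_space q m"
    and lim: "(\<lambda>n. fock_norm q m (\<lambda>z. volterra g (f (r n)) z - h z)) \<longlonglongrightarrow> 0"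
    using cpt f(1,2) unfolding volterra_compact_def by blast
  let ?\<tau> = "\<lambda>n. norm (deriv h (w (r n))) * exp (- psi m (w (r n))) / (1 + norm (w (r n)))"
  have \<tau>: "?\<tau> \<longlonglongrightarrow> 0"
  proof (rule fock_deriv_decay[OF h q])
    show "real n \<le> norm (w (r n))" for n
      using w(1)[of "r n"] seq_suble[OF r, of n] by linarith
  qed
  \<comment> \<open>The weighted derivative of the image is split into the difference from
    \<open>h\<close>, controlled by the norm, and \<open>h\<close> itself. Both terms on the right
    tend to 0, while the left side is a fixed positive number.\<close>
  have "\<kappa> * e / 2 \<le> C * fock_norm q m (\<lambda>z. volterra g (f (r n)) z - h z) + ?\<tau> n" for n
  proof -
    let ?w = "w (r n)" and ?V = "volterra g (f (r n))"
    have hol: "f (r n) holomorphic_on UNIV" "h holomorphic_on UNIV"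
      using f(1) h by (auto simp: fock_space_def)
    have V: "?V \<in> fock_space q m" using cpt f(1) by (auto simp: volterra_compact_def)
    have "deriv (\<lambda>z. ?V z - h z) ?w = deriv ?V ?w - deriv h ?w"
      using volterra_primitive(1)[OF hol(1) g] hol(2)
      by (intro deriv_diff) (auto simp: holomorphic_on_imp_differentiable_at)
    then have "norm (deriv ?V ?w) \<le> norm (deriv (\<lambda>z. ?V z - h z) ?w) + norm (deriv h ?w)"
      using norm_triangle_ineq[of "deriv ?V ?w - deriv h ?w" "deriv h ?w"] by simp
    then have "norm (deriv ?V ?w) * (exp (- psi m ?w) / (1 + norm ?w))
        \<le> (norm (deriv (\<lambda>z. ?V z - h z) ?w) + norm (deriv h ?w)) * (exp (- psi m ?w) / (1 + norm ?w))"
      by (rule mult_right_mono) simp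
    also have "\<dots> = norm (deriv (\<lambda>z. ?V z - h z) ?w) * exp (- psi m ?w) / (1 + norm ?w) + ?\<tau> n"
      by (simp add: distrib_right add_divide_distrib)
    also have "\<dots> \<le> C * fock_norm q m (\<lambda>z. ?V z - h z) + ?\<tau> n"
      by (intro add_right_mono C(2) fock_space_diff V h q)
    also have "norm (deriv ?V ?w) * (exp (- psi m ?w) / (1 + norm ?w)) = norm (g ?w) * (\<kappa> * norm ?w) / (1 + norm ?w)"
      by (simp add: volterra_primitive(2)[OF hol(1) g] norm_mult flip: f(3))
    finally have A: "norm (g ?w) * (\<kappa> * norm ?w) / (1 + norm ?w) \<le> C * fock_norm q m (\<lambda>z. ?V z - h z) + ?\<tau> n" .
    have "\<kappa> * e / 2 = e * \<kappa> * (1 / 2)" by simp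
    also have "\<dots> \<le> norm (g ?w) * \<kappa> * (norm ?w / (1 + norm ?w))"
    proof (intro mult_mono)
      show "1 / 2 \<le> norm ?w / (1 + norm ?w)"
        using w(1)[of "r n"] by (simp add: pos_le_divide_eq add_pos_nonneg)
    qed (use w(2) \<kappa>(1) e(1) in auto)
    also have "\<dots> = norm (g ?w) * (\<kappa> * norm ?w) / (1 + norm ?w)" by simp
    also note A
    finally show ?thesis .
  qed
  moreover have "(\<lambda>n. C * fock_norm q m (\<lambda>z. volterra g (f (r n)) z - h z) + ?\<tau> n) \<longlonglongrightarrow> C * 0 + 0"
    by (intro tendsto_intros lim \<tau>)
  ultimately have "\<kappa> * e / 2 \<le> 0"
    by (intro LIMSEQ_le_const) auto
  with \<kappa>(1) e(1) show False by (simp add: mult_le_0_iff)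
qed

section \<open>Sufficiency: constant and zero symbols\<close>

lemma volterra_bounded_const:
  assumes pq: "0 < p" "p \<le> q"
  shows "volterra_bounded m (\<lambda>_. c) p q"
proof -
  from pq have q: "0 < q" by simp
  obtain E where E: "E > 0" "\<And>f. f \<in> fock_space p m \<Longrightarrow> f \<in> fock_space q m"
    "\<And>f. f \<in> fock_space p m \<Longrightarrow> fock_norm q m f \<le> E * fock_norm p m f"
    using fock_space_embedding[OF pq] by metis
  obtain C where C: "C > 0"
    "\<And>F w. F \<in> fock_space p m \<Longrightarrow> norm (F w) * exp (- psi m w) \<le> C * fock_norm p m F"
    using fock_pointwise_norm[OF pq(1)] by metis
  define N where "N = fock_norm q m (\<lambda>_. 1)"
  have N: "N \<ge> 0" by (simp add: N_def fock_norm_nonneg)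
  \<comment> \<open>The q-th power of the operator bound for c (f - f(0)): \<open>2 powr q\<close>
    from the quasi-triangle inequality, \<open>E\<close> from the inclusion applied to
    \<open>f\<close>, and \<open>C * N\<close> from evaluation at 0, where the weight is 1, times
    the norm of the constant 1.\<close>
  define K where "K = norm c powr q * (2 powr q * (E powr q + (C * N) powr q))"
  have K: "K \<ge> 0" by (simp add: K_def)
  have 1: "(\<lambda>z. c * (f z - f 0)) \<in> fock_space q m" if f: "f \<in> fock_space p m" for f
    by (intro fock_space_cmult fock_space_diff E(2) f fock_space_const q)
  have 2: "fock_norm q m (\<lambda>z. c * (f z - f 0)) \<le> K powr (1 / q) * fock_norm p m f" if f: "f \<in> fock_space p m" for f
  proof (rule fock_norm_le[OF _ q])
    let ?n = "fock_norm p m f"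
    have n: "?n \<ge> 0" by (rule fock_norm_nonneg)
    have [measurable]: "f \<in> borel_measurable borel" using f by (simp add: fock_space_def entire_borel)
    have f0: "norm (f 0) \<le> C * ?n" using C(2)[OF f, of 0] by (simp add: psi_def)
    have "fock_integral q m (\<lambda>z. c * (f z - f 0)) = ennreal (norm c powr q) * fock_integral q m (\<lambda>z. f z - f 0)"
      by (rule fock_integral_cmult) auto
    also have "fock_integral q m (\<lambda>z. f z - f 0) \<le> ennreal (2 powr q) * (fock_integral q m f + fock_integral q m (\<lambda>_. - f 0 * 1))"
      using fock_integral_add_le[of f "\<lambda>_. - f 0" q m] q by simp
    also have "fock_integral q m (\<lambda>_. - f 0 * 1) = ennreal (norm (f 0) powr q) * ennreal (N powr q)"
      unfolding N_def using q by (subst fock_integral_cmult) (auto simp: fock_integral_eq_norm_powr fock_space_const)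
    also have "\<dots> = ennreal ((norm (f 0) * N) powr q)" using N by (simp add: ennreal_mult' powr_mult)
    also have "\<dots> \<le> ennreal ((C * ?n * N) powr q)"
      using f0 N q by (intro ennreal_leI powr_mono2 mult_right_mono) auto
    also have "fock_integral q m f \<le> ennreal ((E * ?n) powr q)"
      unfolding fock_integral_eq_norm_powr[OF E(2)[OF f] q]
      using E(3)[OF f] q by (intro ennreal_leI powr_mono2) (auto simp: fock_norm_nonneg)
    finally have "fock_integral q m (\<lambda>z. c * (f z - f 0)) \<le> ennreal (norm c powr q) * (ennreal (2 powr q) * (ennreal ((E * ?n) powr q) + ennreal ((C * ?n * N) powr q)))"
      by (simp add: mult_left_mono add_right_mono)
    also have "\<dots> = ennreal (norm c powr q * (2 powr q * ((E * ?n) powr q + (C * ?n * N) powr q)))"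
      by (simp add: ennreal_mult')
    also have "norm c powr q * (2 powr q * ((E * ?n) powr q + (C * ?n * N) powr q)) = (K powr (1 / q) * ?n) powr q"
      using E(1) C(1) N n K q by (simp add: powr_mult powr_powr K_def algebra_simps)
    finally show "fock_integral q m (\<lambda>z. c * (f z - f 0)) \<le> ennreal ((K powr (1 / q) * ?n) powr q)" .
  qed (simp add: fock_norm_nonneg)
  show ?thesis
    unfolding volterra_bounded_def
  proof (intro conjI ballI exI[of _ "K powr (1 / q)"])
    fix f assume f: "f \<in> fock_space p m"
    then have "volterra (\<lambda>_. c) f = (\<lambda>z. c * (f z - f 0))" by (intro volterra_const) (simp add: fock_space_def)
    then show "volterra (\<lambda>_. c) f \<in> fock_space q m"
      and "fock_norm q m (volterra (\<lambda>_. c) f) \<le> K powr (1 / q) * fock_norm p m f"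
      using 1[OF f] 2[OF f] by simp_all
  qed
qed

lemma volterra_zero:
  assumes "0 < p" "0 < q"
  shows "volterra_bounded m (\<lambda>_. 0) p q" "volterra_compact m (\<lambda>_. 0) p q"
proof -
  have V: "volterra (\<lambda>_. 0) f = (\<lambda>_. 0)" for f
    by (simp add: volterra_def fun_eq_iff)
  show "volterra_bounded m (\<lambda>_. 0) p q"
    using assms by (auto simp: volterra_bounded_def V fock_space_const fock_norm_zero intro!: exI[of _ 0])
  show "volterra_compact m (\<lambda>_. 0) p q"
    unfolding volterra_compact_def V
  proof (intro conjI ballI allI impI)
    fix fs :: "nat \<Rightarrow> complex \<Rightarrow> complex"
    have "strict_mono (\<lambda>n::nat. n)" by (simp add: strict_mono_def)
    then show "\<exists>r h. strict_mono (r :: nat \<Rightarrow> nat) \<and> h \<in> fock_space q m \<and> (\<lambda>n. fock_norm q m (\<lambda>z. 0 - h z)) \<longlonglongrightarrow> 0"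
      using fock_space_const[OF assms(2), of 0 m]
      by (intro exI[of _ "\<lambda>n. n"] exI[of _ "\<lambda>_. 0"]) (simp add: fock_norm_zero)
  qed (simp add: fock_space_const assms)
qed

section \<open>Monomials and the case q < p\<close>

text \<open>Since |z|^n is at most (1 + |z|)^n, a monomial is dominated by the constant 1 in the
  weight with \<open>m + n\<close>.\<close>

lemma fock_space_monomial:
  assumes p: "0 < p" shows "(\<lambda>z. z ^ n) \<in> fock_space p m"
proof -
  have "fock_integral p m (\<lambda>z. z ^ n) \<le> fock_integral p (m + n) (\<lambda>_. 1)"
  proof (rule fock_integral_mono)
    fix z :: complex
    have "norm z ^ n * ((1 + norm z) ^ m * exp (- (norm z)\<^sup>2 / 2)) \<le> (1 + norm z) ^ n * ((1 + norm z) ^ m * exp (- (norm z)\<^sup>2 / 2))"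
      by (intro mult_right_mono power_mono) auto
    then show "norm (z ^ n) * exp (- psi m z) \<le> norm (1::complex) * exp (- psi (m + n) z)"
      by (simp add: exp_minus_psi norm_power power_add mult_ac)
  qed (use p in simp)
  then show ?thesis
    using fock_integral_const_finite[OF p, of "m + n" 1]
    by (auto simp: fock_space_def intro!: holomorphic_intros)
qed

text \<open>The left side peaks at s = \<open>sqrt n\<close>. There ln x at most x - 1 with x = r /
  s turns n ln r into a linear function of r, and completing the square produces the Gaussian around
  s.\<close>

lemma power_gauss_le:
  fixes r :: real
  assumes n: "n > 0" and r: "r \<ge> 0"
  shows "r ^ n * exp (- r\<^sup>2 / 2) \<le> sqrt n ^ n * exp (- real n / 2) * exp (- (r - sqrt n)\<^sup>2 / 2)"
proof (cases "r = 0")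
  case False
  define s where "s = sqrt n"
  have s: "s > 0" "s\<^sup>2 = n" using n by (auto simp: s_def)
  with False r have r0: "r > 0" by simp
  have "ln r - ln s \<le> r / s - 1"
    using r0 s ln_le_minus_one[of "r / s"] by (simp add: ln_div)
  then have "s\<^sup>2 * (ln r - ln s) \<le> s\<^sup>2 * (r / s - 1)" by (intro mult_left_mono) auto
  also have "\<dots> = s * r - s\<^sup>2" using s(1) by (simp add: power2_eq_square field_simps)
  finally have "n * ln r - n * ln s \<le> s * r - n" by (simp add: s(2) right_diff_distrib)
  moreover have "(r - s)\<^sup>2 = r\<^sup>2 - 2 * (s * r) + n" by (simp add: power2_diff s(2))
  ultimately have "n * ln r + - r\<^sup>2 / 2 \<le> n * ln s + - real n / 2 + - (r - s)\<^sup>2 / 2" by linarith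
  then have "exp (n * ln r + - r\<^sup>2 / 2) \<le> exp (n * ln s + - real n / 2 + - (r - s)\<^sup>2 / 2)" by simp
  then have "exp (n * ln r) * exp (- r\<^sup>2 / 2) \<le> exp (n * ln s) * exp (- real n / 2) * exp (- (r - s)\<^sup>2 / 2)"
    by (simp only: exp_add)
  then show ?thesis using r0 s(1) by (simp add: exp_of_nat_mult s_def)
qed (use n in \<open>simp add: power_0_left\<close>)

text \<open>The converse on an interval of length 1 past the peak, from ln (1 + x) at least x - x^2
  with x = t / s in [0,1]. The exponent loses 3 t^2 / 2, which is below the allowed 2.\<close>

lemma power_gauss_ge:
  fixes r :: real
  assumes n: "n > 0" and r: "sqrt n \<le> r" "r \<le> sqrt n + 1"
  shows "sqrt n ^ n * exp (- real n / 2) * exp (- 2) \<le> r ^ n * exp (- r\<^sup>2 / 2)"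
proof -
  define s where "s = sqrt n"
  define t where "t = r - s"
  have s: "s \<ge> 1" "s\<^sup>2 = n" using n by (auto simp: s_def)
  have t: "0 \<le> t" "t \<le> 1" "r = s + t" using r by (auto simp: t_def s_def)
  have "t / s - (t / s)\<^sup>2 \<le> ln (1 + t / s)"
    using s t by (intro ln_one_plus_pos_lower_bound) auto
  also have "1 + t / s = r / s" using s t by (simp add: field_simps)
  also have "ln (r / s) = ln r - ln s" using s t by (simp add: ln_div)
  finally have "s\<^sup>2 * (t / s - (t / s)\<^sup>2) \<le> s\<^sup>2 * (ln r - ln s)" by (intro mult_left_mono) auto
  moreover have "s\<^sup>2 * (t / s - (t / s)\<^sup>2) = s * t - t\<^sup>2" using s(1) by (simp add: power2_eq_square field_simps)
  ultimately have "s * t - t\<^sup>2 \<le> n * ln r - n * ln s" by (simp add: s(2) right_diff_distrib)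
  moreover have "r\<^sup>2 = n + 2 * (s * t) + t\<^sup>2" by (simp add: t(3) power2_sum s(2))
  moreover have "t\<^sup>2 \<le> 1\<^sup>2" using t by (intro power_mono) auto
  moreover have "x - y \<le> a - b \<Longrightarrow> R = N + 2 * x + y \<Longrightarrow> y \<le> 1\<^sup>2 \<Longrightarrow> b + - N / 2 + - 2 \<le> a + - R / 2"
    for x y a b N R :: real by (simp add: field_simps)
  ultimately have "n * ln s + - real n / 2 + - 2 \<le> n * ln r + - r\<^sup>2 / 2" by blast
  then have "exp (n * ln s + - real n / 2 + - 2) \<le> exp (n * ln r + - r\<^sup>2 / 2)" by simp
  then have "exp (n * ln s) * exp (- real n / 2) * exp (- 2) \<le> exp (n * ln r) * exp (- r\<^sup>2 / 2)"
    by (simp only: exp_add)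
  moreover have "0 < r" using t s(1) by linarith
  ultimately show ?thesis using s(1) by (simp add: exp_of_nat_mult s_def)
qed

text \<open>\<open>S\<close> bounds the weighted monomial everywhere and is attained up to a fixed
  factor on an annulus of width 1. The area of that annulus supplies \<open>sqrt n\<close>, and
  \<open>c\<close> does not depend on \<open>n\<close>.\<close>

lemma fock_monomial_peak:
  assumes q: "0 < q"
  obtains c where "c > 0" "\<And>n::nat. n > 0 \<Longrightarrow> \<exists>S>0. (\<forall>z. norm (z ^ n) * exp (- psi m z) \<le> S) \<and>
    ennreal (c * sqrt n * S powr q) \<le> fock_integral q m (\<lambda>z. z ^ n)"
proof -
  \<comment> \<open>Away from the peak the polynomial weight grows by at most exp(m t) at distance
    t, and m t - t^2 / 2 never exceeds m^2 / 2.\<close>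
  define L where "L = exp ((real m)\<^sup>2 / 2)"
  have L: "L > 0" by (simp add: L_def)
  \<comment> \<open>The q-th power of the ratio between the lower bound \<open>P * exp (- 2)\<close>
    on the annulus and the global bound \<open>P * L\<close>.\<close>
  define c where "c = (exp (- 2) / L) powr q"
  have c: "c > 0" using L by (simp add: c_def)
  have "\<exists>S>0. (\<forall>z. norm (z ^ n) * exp (- psi m z) \<le> S) \<and> ennreal (c * sqrt n * S powr q) \<le> fock_integral q m (\<lambda>z. z ^ n)"
    if n: "n > 0" for n :: nat
  proof -
    let ?s = "sqrt (real n)"
    have s: "?s > 0" using n by simp
    define P where "P = ?s ^ n * exp (- real n / 2) * (1 + ?s) ^ m"
    have P: "P > 0" using s by (simp add: P_def add_pos_pos)
    have upper: "norm (z ^ n) * exp (- psi m z) \<le> P * L" for z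
    proof -
      let ?t = "norm z - ?s"
      have "1 + norm z \<le> (1 + ?s) * (1 + \<bar>?t\<bar>)"
      proof -
        have "(1 + ?s) * (1 + \<bar>?t\<bar>) = 1 + ?s + \<bar>?t\<bar> + ?s * \<bar>?t\<bar>" by (simp add: algebra_simps)
        moreover have "0 \<le> ?s * \<bar>?t\<bar>" by simp
        ultimately show ?thesis by linarith
      qed
      also have "\<dots> \<le> (1 + ?s) * exp \<bar>?t\<bar>"
        using s by (intro mult_left_mono exp_ge_add_one_self) auto
      finally have "(1 + norm z) ^ m \<le> ((1 + ?s) * exp \<bar>?t\<bar>) ^ m"
        by (intro power_mono) auto
      then have 1: "(1 + norm z) ^ m \<le> (1 + ?s) ^ m * exp (m * \<bar>?t\<bar>)"
        by (simp add: power_mult_distrib exp_of_nat_mult)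
      have "0 \<le> (\<bar>?t\<bar> - m)\<^sup>2" by simp
      also have "\<dots> = \<bar>?t\<bar>\<^sup>2 - 2 * (m * \<bar>?t\<bar>) + (real m)\<^sup>2" by (simp only: power2_diff mult_ac)
      finally have "m * \<bar>?t\<bar> + - ?t\<^sup>2 / 2 \<le> (real m)\<^sup>2 / 2" by (simp add: field_simps)
      then have 2: "exp (m * \<bar>?t\<bar>) * exp (- ?t\<^sup>2 / 2) \<le> L"
        unfolding L_def exp_add[symmetric] by simp
      have "norm (z ^ n) * exp (- psi m z) = (norm z ^ n * exp (- (norm z)\<^sup>2 / 2)) * (1 + norm z) ^ m"
        by (simp add: norm_power exp_minus_psi)
      also have "\<dots> \<le> (?s ^ n * exp (- real n / 2) * exp (- ?t\<^sup>2 / 2)) * ((1 + ?s) ^ m * exp (m * \<bar>?t\<bar>))"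
        using s by (intro mult_mono[OF power_gauss_le[OF n] 1]) auto
      also have "\<dots> = P * (exp (m * \<bar>?t\<bar>) * exp (- ?t\<^sup>2 / 2))" by (simp add: P_def)
      also have "\<dots> \<le> P * L" using 2 P by (intro mult_left_mono) auto
      finally show ?thesis .
    qed
    define A where "A = cball 0 (?s + 1) - cball (0::complex) ?s"
    have A[measurable]: "A \<in> sets borel" by (simp add: A_def)
    have "emeasure lborel A = emeasure lborel (cball (0::complex) (?s + 1)) - emeasure lborel (cball (0::complex) ?s)"
      unfolding A_def by (rule emeasure_Diff) (auto simp: emeasure_complex_cball cball_subset_cball_iff)
    also have "\<dots> = ennreal (pi * (?s + 1)\<^sup>2 - pi * ?s\<^sup>2)"
      using s by (simp add: emeasure_complex_cball ennreal_minus)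
    also have "\<dots> \<ge> ennreal ?s"
    proof (rule ennreal_leI)
      have "?s \<le> 1 * (2 * ?s + 1)" using s by simp
      also have "\<dots> \<le> pi * (2 * ?s + 1)" using s pi_gt3 by (intro mult_right_mono) auto
      also have "\<dots> = pi * (?s + 1)\<^sup>2 - pi * ?s\<^sup>2" by (simp add: power2_eq_square algebra_simps)
      finally show "?s \<le> pi * (?s + 1)\<^sup>2 - pi * ?s\<^sup>2" .
    qed
    finally have area: "ennreal ?s \<le> emeasure lborel A" .
    have lower: "P * exp (- 2) \<le> norm (z ^ n) * exp (- psi m z)" if "z \<in> A" for z
    proof -
      have z: "?s \<le> norm z" "norm z \<le> ?s + 1" using that by (auto simp: A_def)
      have "(?s ^ n * exp (- real n / 2) * exp (- 2)) * (1 + ?s) ^ m \<le> (norm z ^ n * exp (- (norm z)\<^sup>2 / 2)) * (1 + norm z) ^ m"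
        using z s by (intro mult_mono[OF power_gauss_ge[OF n]] power_mono) auto
      then show ?thesis by (simp add: P_def norm_power exp_minus_psi mult_ac)
    qed
    have "c * (P * L) powr q = (P * exp (- 2)) powr q"
      using P L by (simp add: c_def powr_mult powr_divide)
    then have "c * ?s * (P * L) powr q = (P * exp (- 2)) powr q * ?s"
      by (metis mult.assoc mult.commute)
    then have "ennreal (c * ?s * (P * L) powr q) = ennreal ((P * exp (- 2)) powr q) * ennreal ?s"
      by (simp only: ennreal_mult' powr_ge_zero)
    also have "\<dots> \<le> ennreal ((P * exp (- 2)) powr q) * emeasure lborel A"
      by (rule mult_left_mono[OF area]) simp
    also have "\<dots> = (\<integral>\<^sup>+z. ennreal ((P * exp (- 2)) powr q) * indicator A z \<partial>lborel)"
      by (subst nn_integral_cmult) auto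
    also have "\<dots> \<le> fock_integral q m (\<lambda>z. z ^ n)"
      unfolding fock_integral_alt
      using lower P q by (intro nn_integral_mono) (auto simp: indicator_def intro!: ennreal_leI powr_mono2)
    finally have "ennreal (c * ?s * (P * L) powr q) \<le> fock_integral q m (\<lambda>z. z ^ n)" .
    with upper P L show ?thesis by (intro exI[of _ "P * L"]) auto
  qed
  with c show thesis using that by blast
qed

text \<open>On monomials the \<open>p\<close>-norm is at most \<open>S\<^sup>1\<^sup>-\<^sup>q\<^sup>/\<^sup>p\<close> times the \<open>q/p\<close>-th power of the \<open>q\<close>-norm, so a
  bounded inclusion would force the \<open>q\<close>-norm to be \<open>O(S)\<close>, against the growth by \<open>\<surd>n\<close>.\<close>
lemma volterra_const_unbounded:
  assumes q: "0 < q" and qp: "q < p" and c: "c \<noteq> 0"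
  shows "\<not> volterra_bounded m (\<lambda>_. c) p q"
proof
  assume bdd: "volterra_bounded m (\<lambda>_. c) p q"
  have p: "0 < p" using assms by simp
  obtain D0 where D0: "\<And>f. f \<in> fock_space p m \<Longrightarrow> fock_norm q m (volterra (\<lambda>_. c) f) \<le> D0 * fock_norm p m f"
    using bdd by (auto simp: volterra_bounded_def)
  define D where "D = \<bar>D0\<bar> / norm c"
  have D: "D \<ge> 0" by (simp add: D_def)
  \<comment> \<open>The reciprocal of 1/q - 1/p. Raising the final estimate to this power isolates
    \<open>X\<close> on the left and turns the power of \<open>S\<close> into
    \<open>S powr q\<close>, which then cancels.\<close>
  define d where "d = q * p / (p - q)"
  have d: "d > 0" using p q qp by (simp add: d_def)
  obtain k where k: "k > 0" "\<And>n::nat. n > 0 \<Longrightarrow> \<exists>S>0. (\<forall>z. norm (z ^ n) * exp (- psi m z) \<le> S) \<and>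
    ennreal (k * sqrt n * S powr q) \<le> fock_integral q m (\<lambda>z. z ^ n)"
    using fock_monomial_peak[OF q] by blast
  have main: "k * sqrt n \<le> D powr d" if n: "n > 0" for n :: nat
  proof -
    obtain S where S: "S > 0" "\<And>z. norm (z ^ n) * exp (- psi m z) \<le> S"
      "ennreal (k * sqrt n * S powr q) \<le> fock_integral q m (\<lambda>z. z ^ n)"
      using k(2)[OF n] by blast
    let ?f = "\<lambda>z::complex. z ^ n"
    have f: "?f \<in> fock_space p m" "?f \<in> fock_space q m" using p q by (auto intro: fock_space_monomial)
    have mf: "?f \<in> borel_measurable borel" by measurable
    define X where "X = fock_norm q m ?f powr q"
    have X: "fock_integral q m ?f = ennreal X" unfolding X_def by (rule fock_integral_eq_norm_powr[OF f(2) q])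
    have XS: "k * sqrt n * S powr q \<le> X"
      using S(3) k(1) by (subst (asm) X, subst (asm) ennreal_le_iff) (auto simp: X_def)
    moreover have "k * sqrt n * S powr q > 0" using k(1) n S(1) by simp
    ultimately have X0: "X > 0" by linarith
    \<comment> \<open>For positive \<open>n\<close> the monomial vanishes at 0, so the operator acts
      on it as multiplication by \<open>c\<close>.\<close>
    have "volterra (\<lambda>_. c) ?f = (\<lambda>z. c * ?f z)"
      using n by (subst volterra_const) (auto intro!: holomorphic_intros simp: fun_eq_iff)
    then have "fock_norm q m (\<lambda>z. c * ?f z) \<le> D0 * fock_norm p m ?f"
      using D0[OF f(1)] by simp
    also have "fock_norm q m (\<lambda>z. c * ?f z) = norm c * X powr (1 / q)"
      using X0 q unfolding fock_norm_def fock_integral_cmult[OF mf] X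
      by (simp add: enn2real_mult powr_mult powr_powr)
    finally have "norm c * X powr (1 / q) \<le> \<bar>D0\<bar> * fock_norm p m ?f"
      using fock_norm_nonneg[of p m ?f] by (meson abs_ge_self mult_right_mono order_trans)
    then have 1: "X powr (1 / q) \<le> D * fock_norm p m ?f"
      using c by (simp add: D_def field_simps)
    have "fock_integral p m ?f \<le> ennreal (S powr (p - q)) * fock_integral q m ?f"
      using q qp S(2) mf by (intro fock_integral_interpolate) auto
    also have "\<dots> = ennreal (((S powr (p - q) * X) powr (1 / p)) powr p)"
      using p X0 S(1) by (simp add: X ennreal_mult' powr_powr)
    finally have "fock_norm p m ?f \<le> (S powr (p - q) * X) powr (1 / p)"
      by (rule fock_norm_le) (use p in auto)
    also have "\<dots> = S powr ((p - q) / p) * X powr (1 / p)"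
      using X0 S(1) by (simp add: powr_mult powr_powr)
    finally have "D * fock_norm p m ?f \<le> D * (S powr ((p - q) / p) * X powr (1 / p))"
      using D by (intro mult_left_mono)
    with 1 have "X powr (1 / q) \<le> (D * S powr ((p - q) / p)) * X powr (1 / p)" by (simp add: mult.assoc)
    then have "X powr (1 / q - 1 / p) \<le> D * S powr ((p - q) / p)"
      using X0 by (simp add: powr_diff divide_le_eq)
    then have "(X powr (1 / q - 1 / p)) powr d \<le> (D * S powr ((p - q) / p)) powr d"
      using d by (intro powr_mono2) auto
    moreover have "(1 / q - 1 / p) * d = 1" "(p - q) / p * d = q"
      using p q qp by (auto simp: d_def field_simps)
    ultimately have "X \<le> D powr d * S powr q"
      using X0 D S(1) by (simp add: powr_mult powr_powr)
    with XS have "(k * sqrt n) * S powr q \<le> D powr d * S powr q" by simp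
    then show ?thesis using S(1) by simp
  qed
  obtain n :: nat where n: "(D powr d / k)\<^sup>2 < real n" using reals_Archimedean2 by blast
  then have n0: "n > 0" by (metis of_nat_0 gr0I not_less zero_le_power2)
  have "D powr d / k < sqrt n" using real_less_rsqrt[OF n] .
  with main[OF n0] k(1) show False by (simp add: field_simps)
qed

section \<open>Assembling the two cases\<close>

theorem theorem2:
  fixes m :: nat and g :: "complex \<Rightarrow> complex" and p q :: real
  assumes "g holomorphic_on UNIV" and "0 < p" and "0 < q"
  shows "(p \<le> q \<longrightarrow>
            (volterra_bounded m g p q \<longleftrightarrow> (\<exists>c. \<forall>z. g z = c)) \<and>
            (volterra_compact m g p q \<longleftrightarrow> (\<forall>z. g z = 0)))
       \<and> (q < p \<longrightarrow>
            (volterra_bounded m g p q \<longleftrightarrow> volterra_compact m g p q) \<and>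
            (volterra_compact m g p q \<longleftrightarrow> (\<forall>z. g z = 0)))"
proof -
  have compact: "volterra_compact m g p q \<longleftrightarrow> (\<forall>z. g z = 0)"
  proof
    assume "volterra_compact m g p q"
    then show "\<forall>z. g z = 0" using volterra_compact_imp_zero[OF assms] by blast
  next
    assume "\<forall>z. g z = 0"
    then have "g = (\<lambda>_. 0)" by auto
    then show "volterra_compact m g p q" using volterra_zero(2)[OF assms(2,3)] by simp
  qed
  have const: "g = (\<lambda>_. g 0)" if "volterra_bounded m g p q"
    using volterra_bounded_imp_constant[OF assms that] by blast
  have bounded_le: "volterra_bounded m g p q \<longleftrightarrow> (\<exists>c. \<forall>z. g z = c)" if "p \<le> q"
  proof
    assume "\<exists>c. \<forall>z. g z = c"
    then obtain c where "g = (\<lambda>_. c)" by auto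
    then show "volterra_bounded m g p q" using volterra_bounded_const[OF assms(2) that] by simp
  qed (use const in metis)
  have bounded_gt: "volterra_bounded m g p q \<longleftrightarrow> (\<forall>z. g z = 0)" if "q < p"
  proof
    assume b: "volterra_bounded m g p q"
    then show "\<forall>z. g z = 0" using const volterra_const_unbounded[OF assms(3) that, of "g 0" m] by metis
  next
    assume "\<forall>z. g z = 0"
    then have "g = (\<lambda>_. 0)" by auto
    then show "volterra_bounded m g p q" using volterra_zero(1)[OF assms(2,3)] by simp
  qed
  show ?thesis using compact bounded_le bounded_gt by blast
qed

end
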